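(* Let $A \in M_n(\mathbb{C})$ be a PSD contraction with diagonal entries all at most $\alpha$, where $\alpha \leq 1/2$. Then there are diagonal projections $Q_1,Q_2,Q_3,Q_4 \in M_n(\mathbb{C})$ such that \[\sum_{i=1}^4 Q_i = I \qquad \text{and} \qquad \|Q_i A Q_i\| \leq \frac{7+2\sqrt{6}}{12} \quad \text{for all } i \in \{1,2,3,4\}.\]
   Context: A PSD contraction is a Hermitian matrix with all eigenvalues in $[0,1]$. A diagonal projection is a diagonal matrix $Q$ with $Q = Q^* = Q^2$ (i.e. all diagonal entries in $\{0,1\}$; $Q=0$ is allowed). $\|\cdot\|$ is the operator norm. *)

theory Defs
  imports "HOL-Analysis.Analysis"
begin

definition conjugate_transpose :: "complex ^ 'n ^ 'm \<Rightarrow> complex ^ 'm ^ 'n" where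
  "conjugate_transpose A = (\<chi> i j. cnj (A $ j $ i))"

definition hermitian :: "complex ^ 'n ^ 'n \<Rightarrow> bool" where
  "hermitian A \<longleftrightarrow> conjugate_transpose A = A"

definition eigenvalue :: "complex ^ 'n ^ 'n \<Rightarrow> complex \<Rightarrow> bool" where
  "eigenvalue A c \<longleftrightarrow> (\<exists>v. v \<noteq> 0 \<and> A *v v = c *s v)"

definition psd_contraction :: "complex ^ 'n ^ 'n \<Rightarrow> bool" where
  "psd_contraction A \<longleftrightarrow>
     hermitian A \<and> (\<forall>c. eigenvalue A c \<longrightarrow> c \<in> complex_of_real ` {0..1})"

definition diagonal_matrix :: "complex ^ 'n ^ 'n \<Rightarrow> bool" where
  "diagonal_matrix A \<longleftrightarrow> (\<forall>i j. i \<noteq> j \<longrightarrow> A $ i $ j = 0)"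

definition diagonal_projection :: "complex ^ 'n ^ 'n \<Rightarrow> bool" where
  "diagonal_projection Q \<longleftrightarrow>
     diagonal_matrix Q \<and> Q = conjugate_transpose Q \<and> Q = Q ** Q"

(* The norm of complex ^ 'n is the Euclidean (l2) norm, so onorm yields the
   Hilbert-space operator norm of the matrix. *)
definition operator_norm :: "complex ^ 'n ^ 'n \<Rightarrow> real" where
  "operator_norm A = onorm (\<lambda>v. A *v v)"

end

theory Submission
  imports Defs "HOL-Computational_Algebra.Fundamental_Theorem_Algebra"
begin

text \<open>
  For blocks \<open>S\<^sub>1, \<dots>, S\<^sub>r\<close> consider the sum, over all assignments of the remaining indices to blocks, of
  the products of the characteristic polynomials of the principal submatrices of \<open>A\<close>. Giving every
  (block, index) pair its own variable turns it into a real stable multiaffine polynomial, so that a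
  derivative of such a polynomial interlaces it. Interlacing allows the indices to be assigned one after the other
  without increasing the largest root on the diagonal.

  The largest root of the full sum is bounded by a barrier argument. Start from \<open>det (x - A)^r\<close> at the
  point \<open>t\<close> in every variable, above all roots. Summing over the block of an index \<open>i\<close> amounts to taking the
  \<open>(r - 1)\<close>-st derivative in \<open>x\<^sub>i\<close>, which replaces the \<open>r\<close> roots \<open>t - s\<^sub>l\<close> in \<open>x\<^sub>i\<close> by their mean. The
  logarithmic derivatives in the other variables lie in the cone spanned by a constant and by
  \<open>1 / (x\<^sub>i - (t - s\<^sub>l))\<close>, and on these generators one sees that they do not increase if \<open>x\<^sub>i\<close> is at the same
  time lowered by \<open>\<delta>\<close>, provided that \<open>r \<delta> \<le> (\<Sum>m\<noteq>l. s\<^sub>m)\<close> for all \<open>l\<close>. Since \<open>A\<close> is positive the roots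
  in \<open>x\<^sub>i\<close> are nonnegative, so \<open>s\<^sub>l \<le> t\<close>, and the bound on \<open>(\<Sum>l. 1 / s\<^sub>l)\<close> inherited from the resolvent of \<open>A\<close>
  at \<open>t\<close> yields an admissible \<open>\<delta>\<close>. Optimising over \<open>t\<close> gives \<open>t = (1 + sqrt 6) / 3\<close> for \<open>r = 4\<close>.
\<close>

section \<open>Hermitian forms and principal determinants\<close>

lemma inner_complex_vec: "v \<bullet> w = Re (\<Sum>i\<in>UNIV. v $ i * cnj (w $ i))"
  for v w :: "complex ^ 'n"
  by (simp add: inner_vec_def inner_complex_def)

lemma hermitian_cnj: "hermitian A \<Longrightarrow> cnj (A $ i $ j) = A $ j $ i"
  unfolding hermitian_def conjugate_transpose_def by (metis vec_lambda_beta)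

lemma hermitian_form_sym:
  assumes "hermitian A"
  shows "(\<Sum>i\<in>UNIV. (A *v v) $ i * cnj (w $ i)) = (\<Sum>i\<in>UNIV. v $ i * cnj ((A *v w) $ i))"
proof -
  have "(\<Sum>i\<in>UNIV. (A *v v) $ i * cnj (w $ i)) = (\<Sum>i\<in>UNIV. \<Sum>j\<in>UNIV. A $ i $ j * v $ j * cnj (w $ i))"
    by (simp add: matrix_vector_mult_def sum_distrib_right)
  also have "\<dots> = (\<Sum>j\<in>UNIV. \<Sum>i\<in>UNIV. A $ i $ j * v $ j * cnj (w $ i))"
    by (rule sum.swap)
  also have "\<dots> = (\<Sum>j\<in>UNIV. v $ j * cnj ((A *v w) $ j))"
    by (simp add: matrix_vector_mult_def sum_distrib_left hermitian_cnj[OF assms] mult_ac)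
  finally show ?thesis .
qed

lemma hermitian_inner:
  assumes "hermitian A"
  shows "(A *v v) \<bullet> w = v \<bullet> (A *v w)"
  by (simp only: inner_complex_vec hermitian_form_sym[OF assms])

lemma of_real_vector_scalar: "complex_of_real c *s v = c *\<^sub>R v"
  by (simp add: vec_eq_iff scaleR_conv_of_real[where 'a = complex])

lemma matrix_vector_scaleR: "A *v (c *\<^sub>R v) = c *\<^sub>R (A *v v)" for A :: "complex ^ 'n ^ 'm"
  by (simp add: vec_eq_iff matrix_vector_mult_def scaleR_sum_right)

lemma continuous_on_mult_vec: "continuous_on S (\<lambda>v. A *v v)" for A :: "complex ^ 'n ^ 'm"
  unfolding matrix_vector_mult_def
  by (intro continuous_on_vec_lambda continuous_intros)

text \<open>Moving from \<open>v\<close> along \<open>w = P v\<close> changes the form to first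
  order by \<open>2 s (w . w)\<close>, so a zero of a nonnegative form with \<open>P v\<close>
  nonzero would force negative values for small negative \<open>s\<close>.\<close>

lemma psd_form_eq_zero:
  assumes P: "hermitian P" and nn: "\<And>w. 0 \<le> w \<bullet> (P *v w)" and z: "v \<bullet> (P *v v) = 0"
  shows "P *v v = 0"
proof (rule ccontr)
  assume "P *v v \<noteq> 0"
  define w where "w = P *v v"
  have wp: "w \<bullet> w > 0" using \<open>P *v v \<noteq> 0\<close> by (simp add: w_def)
  define c where "c = w \<bullet> (P *v w)"
  have q: "0 \<le> 2 * s * (w \<bullet> w) + s\<^sup>2 * c" for s
  proof -
    have "0 \<le> (v + s *\<^sub>R w) \<bullet> (P *v (v + s *\<^sub>R w))" by (rule nn)
    also have "\<dots> = v \<bullet> (P *v v) + s * (w \<bullet> (P *v v)) + s * (v \<bullet> (P *v w)) + s\<^sup>2 * (w \<bullet> (P *v w))"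
      by (simp add: matrix_vector_right_distrib matrix_vector_scaleR inner_add_left inner_add_right
          power2_eq_square algebra_simps)
    also have "v \<bullet> (P *v w) = w \<bullet> w"
      using hermitian_inner[OF P, of v w] by (simp add: w_def)
    finally show ?thesis using z by (simp add: w_def c_def)
  qed
  have c0: "c \<ge> 0" using nn by (simp add: c_def)
  \<comment> \<open>The \<open>+ 1\<close> keeps the denominator positive when \<open>c = 0\<close>;
    \<open>2 (w . w) + s c\<close> then equals \<open>(w . w) - s\<close>, which is
    positive.\<close>
  define s where "s = - (w \<bullet> w) / (c + 1)"
  have "s < 0" using c0 wp by (simp add: s_def)
  have sc: "s * (c + 1) = - (w \<bullet> w)" using c0 by (simp add: s_def)
  have "0 \<le> s * (2 * (w \<bullet> w) + s * c)" using q[of s] by (simp add: algebra_simps power2_eq_square)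
  then have "2 * (w \<bullet> w) + s * c \<le> 0" using \<open>s < 0\<close> by (simp add: zero_le_mult_iff)
  moreover have "s * c = - (w \<bullet> w) - s" using sc by (simp add: algebra_simps)
  ultimately show False using wp \<open>s < 0\<close> by simp
qed

text \<open>Compactness gives a maximiser of the Rayleigh quotient. The form of
  \<open>l I - B\<close> is nonnegative and vanishes there, so \<open>psd_form_eq_zero\<close> makes
  the maximiser an eigenvector.\<close>

lemma rayleigh_max:
  fixes B :: "complex ^ 'n ^ 'n"
  assumes B: "hermitian B"
  obtains l v where "v \<noteq> 0" "B *v v = complex_of_real l *s v" "\<And>w. w \<bullet> (B *v w) \<le> l * (w \<bullet> w)"
proof -
  have ne: "sphere (0::complex ^ 'n) 1 \<noteq> {}"
    by simp
  have "continuous_on (sphere 0 1) (\<lambda>v. v \<bullet> (B *v v))"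
    by (intro continuous_intros continuous_on_mult_vec)
  then obtain v where v: "v \<in> sphere 0 1" and mx: "\<And>w. w \<in> sphere 0 1 \<Longrightarrow> w \<bullet> (B *v w) \<le> v \<bullet> (B *v v)"
    using continuous_attains_sup[OF compact_sphere ne] by blast
  define l where "l = v \<bullet> (B *v v)"
  have vv: "v \<bullet> v = 1" using v by (simp add: dot_square_norm)
  have le: "w \<bullet> (B *v w) \<le> l * (w \<bullet> w)" for w
  proof (cases "w = 0")
    case False
    let ?u = "(1 / norm w) *\<^sub>R w"
    have "?u \<bullet> (B *v ?u) \<le> l" unfolding l_def using False by (intro mx) simp
    then have "(w \<bullet> (B *v w)) / (norm w)\<^sup>2 \<le> l"
      by (simp only: matrix_vector_scaleR inner_scaleR_left inner_scaleR_right) (simp add: power2_eq_square)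
    then show ?thesis using False by (simp add: divide_le_eq dot_square_norm)
  qed simp
  define P where "P = (\<chi> i j. (if i = j then complex_of_real l else 0) - B $ i $ j)"
  have Pm: "P *v w = l *\<^sub>R w - B *v w" for w
    by (simp add: P_def vec_eq_iff matrix_vector_mult_def left_diff_distrib sum_subtractf
        if_distrib[of "\<lambda>x. x * _"] scaleR_conv_of_real[where 'a = complex] cong: if_cong)
  have hP: "hermitian P"
    using hermitian_cnj[OF B] by (simp add: hermitian_def conjugate_transpose_def P_def vec_eq_iff)
  have "P *v v = 0"
    by (rule psd_form_eq_zero[OF hP]) (use le in \<open>simp_all add: Pm inner_diff_right vv l_def\<close>)
  then have "B *v v = complex_of_real l *s v"
    by (simp add: Pm of_real_vector_scalar)
  moreover have "v \<noteq> 0" using v by auto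
  ultimately show ?thesis using le that by blast
qed

text \<open>Eigenvalues are replaced by bounds on the quadratic form, which can be tested directly
  on kernel vectors of principal submatrices.\<close>

locale psd_contractive =
  fixes A :: "complex ^ 'n ^ 'n"
  assumes herm: "hermitian A"
    and form_nonneg: "0 \<le> v \<bullet> (A *v v)"
    and form_le: "v \<bullet> (A *v v) \<le> v \<bullet> v"

text \<open>Applying \<open>rayleigh_max\<close> to \<open>A\<close> bounds its form by the top
  eigenvalue, applying it to \<open>- A\<close> bounds it below by the bottom one.\<close>

lemma psd_contractiveI:
  assumes "psd_contraction A"
  shows "psd_contractive A"
proof
  from assms have h: "hermitian A" and ev: "\<And>c. eigenvalue A c \<Longrightarrow> c \<in> complex_of_real ` {0..1}"
    by (auto simp: psd_contraction_def)
  show "hermitian A" by fact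
  fix v
  obtain l u where l: "u \<noteq> 0" "A *v u = complex_of_real l *s u" "\<And>w. w \<bullet> (A *v w) \<le> l * (w \<bullet> w)"
    using rayleigh_max[OF h] by metis
  have "eigenvalue A (complex_of_real l)" using l by (auto simp: eigenvalue_def)
  then have "l \<le> 1" using ev by fastforce
  then show "v \<bullet> (A *v v) \<le> v \<bullet> v"
    using l(3)[of v] mult_right_mono[of l 1 "v \<bullet> v"] by simp
  have "hermitian (- A)" using hermitian_cnj[OF h]
    by (simp add: hermitian_def conjugate_transpose_def vec_eq_iff)
  then obtain m u where m: "u \<noteq> 0" "(- A) *v u = complex_of_real m *s u" "\<And>w. w \<bullet> ((-A) *v w) \<le> m * (w \<bullet> w)"
    using rayleigh_max by metis
  have neg: "(- A) *v w = - (A *v w)" for w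
    by (simp add: vec_eq_iff matrix_vector_mult_def sum_negf)
  have "A *v u = complex_of_real (- m) *s u" using m(2) by (simp add: neg vec_eq_iff) (metis minus_minus)
  then have "m \<le> 0" using ev[of "complex_of_real (- m)"] m(1)
    unfolding eigenvalue_def by (metis (no_types, lifting) atLeastAtMost_iff imageE neg_0_le_iff_le of_real_eq_iff)
  then show "0 \<le> v \<bullet> (A *v v)"
    using m(3)[of v] mult_right_mono[of m 0 "v \<bullet> v"] by (simp add: neg)
qed

section \<open>Principal determinants of diag(x) - A\<close>

context psd_contractive
begin

text \<open>The principal submatrix on \<open>S\<close> is padded by the identity: the determinant
  is still the principal minor, and all \<open>S\<close> share one matrix type.\<close>

definition pmat :: "'n set \<Rightarrow> ('n \<Rightarrow> complex) \<Rightarrow> complex ^ 'n ^ 'n" where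
  "pmat S x = (\<chi> i j. if i \<in> S \<and> j \<in> S then (if i = j then x i else 0) - A $ i $ j
                     else if i = j then 1 else 0)"

definition pdet :: "'n set \<Rightarrow> ('n \<Rightarrow> complex) \<Rightarrow> complex" where
  "pdet S x = det (pmat S x)"

lemma pdet_empty [simp]: "pdet {} x = 1"
proof -
  have "pmat {} x = mat 1" by (simp add: pmat_def mat_def vec_eq_iff)
  then show ?thesis by (simp add: pdet_def)
qed

lemma pdet_cong: "(\<And>i. i \<in> S \<Longrightarrow> x i = y i) \<Longrightarrow> pdet S x = pdet S y"
proof -
  assume "\<And>i. i \<in> S \<Longrightarrow> x i = y i"
  then have "pmat S x = pmat S y" by (simp add: pmat_def vec_eq_iff)
  then show ?thesis by (simp add: pdet_def)
qed

text \<open>In the Leibniz expansion only permutations fixing \<open>i\<close> survive, and these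
  never use column \<open>i\<close> in another row, so that column may be cleared.\<close>

lemma det_unit_row:
  "det (\<chi> l. if l = i then c *s axis i 1 else M l) = c * det (\<chi> l. if l = i then axis i 1 else
      (\<chi> j. if j = i then 0 else M l $ j))" for M :: "'n \<Rightarrow> complex ^ 'n"
proof -
  have "det (\<chi> l. if l = i then c *s axis i 1 else M l) = c * det (\<chi> l. if l = i then axis i 1 else M l)"
    by (rule det_row_mul)
  also have "det (\<chi> l. if l = i then axis i 1 else M l) = det (\<chi> l. if l = i then axis i 1 else
      (\<chi> j. if j = i then 0 else M l $ j))"
    unfolding det_def
  proof (rule sum.cong)
    fix p assume p: "p \<in> {p. p permutes (UNIV :: 'n set)}"
    have "(\<Prod>l\<in>UNIV. (\<chi> l. if l = i then axis i 1 else M l) $ l $ p l) =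
      (\<Prod>l\<in>UNIV. (\<chi> l. if l = i then axis i 1 else (\<chi> j. if j = i then 0 else M l $ j)) $ l $ p l)"
    proof (cases "p i = i")
      case True
      have "p l \<noteq> i" if "l \<noteq> i" for l
        using True that p by (metis mem_Collect_eq permutes_def)
      then show ?thesis by (intro prod.cong) auto
    next
      case False
      have "(\<Prod>l\<in>UNIV. (\<chi> l. if l = i then axis i 1 else M l) $ l $ p l) = 0"
        using False by (intro prod_zero) (auto simp: axis_def intro!: bexI[of _ i])
      moreover have "(\<Prod>l\<in>UNIV. (\<chi> l. if l = i then axis i 1 else (\<chi> j. if j = i then 0 else M l $ j)) $ l $ p l) = 0"
        using False by (intro prod_zero) (auto simp: axis_def intro!: bexI[of _ i])
      ultimately show ?thesis by (simp only:)
    qed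
    then show "of_int (sign p) * (\<Prod>l\<in>UNIV. (\<chi> l. if l = i then axis i 1 else M l) $ l $ p l) =
      of_int (sign p) * (\<Prod>l\<in>UNIV. (\<chi> l. if l = i then axis i 1 else (\<chi> j. if j = i then 0 else M l $ j)) $ l $ p l)"
      by simp
  qed simp
  finally show ?thesis .
qed

text \<open>Row \<open>i\<close> depends on \<open>x i\<close> only through its diagonal entry, so
  the determinant is affine in \<open>x i\<close>, with the minor lacking \<open>i\<close> as
  slope.\<close>

lemma pdet_bump:
  assumes i: "i \<in> S"
  shows "pdet S (x(i := x i + h)) = pdet S x + h * pdet (S - {i}) x"
proof -
  let ?M = "\<lambda>l. pmat S x $ l"
  have 1: "pmat S (x(i := x i + h)) = (\<chi> l. if l = i then h *s axis i 1 + ?M l else ?M l)"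
    using i by (auto simp: pmat_def vec_eq_iff axis_def)
  have 2: "(\<chi> l. if l = i then ?M l else ?M l) = pmat S x"
    by (simp add: vec_eq_iff)
  have 3: "(\<chi> l. if l = i then axis i 1 else (\<chi> j. if j = i then 0 else ?M l $ j)) = pmat (S - {i}) x"
    using i by (auto simp: pmat_def vec_eq_iff axis_def)
  have "pdet S (x(i := x i + h)) = det (\<chi> l. if l = i then h *s axis i 1 else ?M l) + det (pmat S x)"
    by (simp only: pdet_def 1 det_row_add 2)
  also have "det (\<chi> l. if l = i then h *s axis i 1 else ?M l) = h * pdet (S - {i}) x"
    by (simp add: det_unit_row 3 pdet_def)
  finally show ?thesis by (simp only: pdet_def add.commute)
qed

lemma pdet_singleton: "pdet {i} x = x i - A $ i $ i"
proof -
  have e: "pdet {i} (x(i := x i + (A $ i $ i - x i))) = pdet {i} x + (A $ i $ i - x i) * pdet ({i} - {i}) x"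
    by (rule pdet_bump) simp
  have "pdet {i} (x(i := A $ i $ i)) = 0"
    unfolding pdet_def
    by (rule det_zero_row(1)[where i = i]) (auto simp: pmat_def row_def vec_eq_iff)
  with e show ?thesis by (simp add: algebra_simps)
qed

lemma pdet_holomorphic:
  assumes "\<And>i. (\<lambda>s. x s i) holomorphic_on U"
  shows "(\<lambda>s. pdet S (x s)) holomorphic_on U"
proof -
  have "(\<lambda>s. pmat S (x s) $ (i::'n) $ (j::'n)) holomorphic_on U" for i j
    using assms by (cases "i \<in> S \<and> j \<in> S"; cases "i = j") (auto simp: pmat_def intro!: holomorphic_intros)
  then show ?thesis unfolding pdet_def det_def by (intro holomorphic_intros)
qed

lemma pdet_cnj: "pdet S (\<lambda>i. cnj (x i)) = cnj (pdet S x)"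
proof -
  have "pmat S (\<lambda>i. cnj (x i)) = (\<chi> i j. cnj (transpose (pmat S x) $ i $ j))"
    by (auto simp: pmat_def vec_eq_iff transpose_def hermitian_cnj[OF herm])
  then have "pdet S (\<lambda>i. cnj (x i)) = det (\<chi> i j. cnj (transpose (pmat S x) $ i $ j))"
    by (simp add: pdet_def)
  also have "\<dots> = cnj (det (transpose (pmat S x)))"
    by (simp add: det_def)
  finally show ?thesis by (simp add: pdet_def det_transpose)
qed

lemma pmat_kernel:
  assumes "pdet S x = 0"
  obtains v where "v \<noteq> 0" "\<And>i. i \<notin> S \<Longrightarrow> v $ i = 0" "\<And>i. i \<in> S \<Longrightarrow> x i * v $ i = (A *v v) $ i"
proof -
  have "\<not> invertible (pmat S x)" using assms by (simp add: invertible_det_nz pdet_def)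
  then obtain v where v: "v \<noteq> 0" "pmat S x *v v = 0"
    unfolding invertible_left_inverse matrix_left_invertible_ker by blast
  have row: "(\<Sum>j\<in>UNIV. pmat S x $ i $ j * v $ j) = 0" for i
    using v(2) by (simp add: vec_eq_iff matrix_vector_mult_def)
  have out: "v $ i = 0" if "i \<notin> S" for i
    using row[of i] that by (simp add: pmat_def if_distrib[of "\<lambda>x. x * _"] cong: if_cong)
  have "x i * v $ i = (A *v v) $ i" if i: "i \<in> S" for i
  proof -
    have "(\<Sum>j\<in>UNIV. pmat S x $ i $ j * v $ j) = (\<Sum>j\<in>UNIV. (if i = j then x i * v $ j else 0) - A $ i $ j * v $ j)"
      using i out by (intro sum.cong) (auto simp: pmat_def algebra_simps)
    then show ?thesis using row[of i]
      by (simp add: sum_subtractf matrix_vector_mult_def)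
  qed
  with v out that show ?thesis by blast
qed

lemma form_kernel:
  assumes "\<And>i. i \<notin> S \<Longrightarrow> v $ i = 0" "\<And>i. i \<in> S \<Longrightarrow> x i * v $ i = (A *v v) $ i"
  shows "(\<Sum>i\<in>UNIV. (A *v v) $ i * cnj (v $ i)) = (\<Sum>i\<in>UNIV. x i * complex_of_real ((norm (v $ i))\<^sup>2))"
  using assms by (intro sum.cong) (metis complex_norm_square complex_cnj_zero mult.assoc mult_zero_right norm_zero of_real_0 zero_power2)+

lemma vec_eq_0_if_sum_le:
  assumes "(\<Sum>i\<in>UNIV. c i * (norm (v $ i))\<^sup>2) \<le> 0" "\<And>i. c i > (0::real)"
  shows "v = (0 :: complex ^ 'n)"
proof -
  have "(\<Sum>i\<in>UNIV. c i * (norm (v $ i))\<^sup>2) = 0"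
    using assms by (intro antisym sum_nonneg) (auto simp: less_imp_le)
  then have "\<And>i. c i * (norm (v $ i))\<^sup>2 = 0"
    using assms(2) by (subst (asm) sum_nonneg_eq_0_iff) (auto simp: less_imp_le)
  then show ?thesis using assms(2) by (auto simp: vec_eq_iff) (metis less_irrefl)
qed

text \<open>On a kernel vector \<open>v\<close> the Hermitian form would be the sum of
  \<open>x i |v i|^2\<close>. It is real, which positive imaginary parts exclude.\<close>

lemma pdet_upper_nonzero:
  assumes "\<And>i. Im (x i) > 0"
  shows "pdet S x \<noteq> 0"
proof
  assume "pdet S x = 0"
  then obtain v where v: "v \<noteq> 0" "\<And>i. i \<notin> S \<Longrightarrow> v $ i = 0" "\<And>i. i \<in> S \<Longrightarrow> x i * v $ i = (A *v v) $ i"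
    using pmat_kernel by blast
  let ?q = "\<Sum>i\<in>UNIV. (A *v v) $ i * cnj (v $ i)"
  have fk: "?q = (\<Sum>i\<in>UNIV. x i * complex_of_real ((norm (v $ i))\<^sup>2))"
    using v(2,3) by (rule form_kernel)
  have "cnj ?q = ?q"
    using hermitian_form_sym[OF herm, of v v] by (simp add: mult.commute)
  then have "Im ?q = 0" by (metis Reals_cnj_iff complex_is_Real_iff)
  then have "(\<Sum>i\<in>UNIV. Im (x i) * (norm (v $ i))\<^sup>2) = 0"
    using arg_cong[OF fk, of Im] by simp
  then have "v = 0" using assms by (intro vec_eq_0_if_sum_le[of "\<lambda>i. Im (x i)"]) auto
  with v(1) show False ..
qed

lemma pdet_real_nonzero:
  assumes "\<And>i. x i > 1"
  shows "pdet S (\<lambda>i. complex_of_real (x i)) \<noteq> 0"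
proof
  assume "pdet S (\<lambda>i. complex_of_real (x i)) = 0"
  then obtain v where v: "v \<noteq> 0" "\<And>i. i \<notin> S \<Longrightarrow> v $ i = 0"
      "\<And>i. i \<in> S \<Longrightarrow> complex_of_real (x i) * v $ i = (A *v v) $ i"
    using pmat_kernel[of S "\<lambda>i. complex_of_real (x i)"] by blast
  have "(\<Sum>i\<in>UNIV. (A *v v) $ i * cnj (v $ i)) =
      (\<Sum>i\<in>UNIV. complex_of_real (x i) * complex_of_real ((norm (v $ i))\<^sup>2))"
    using v(2,3) by (rule form_kernel)
  from arg_cong[OF this, of Re] have "(\<Sum>i\<in>UNIV. x i * (norm (v $ i))\<^sup>2) = (A *v v) \<bullet> v"
    by (simp add: inner_complex_vec)
  also have "\<dots> \<le> v \<bullet> v" using form_le by (simp add: inner_commute)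
  also have "\<dots> = (\<Sum>i\<in>UNIV. (norm (v $ i))\<^sup>2)"
    by (simp add: inner_vec_def dot_square_norm)
  finally have "(\<Sum>i\<in>UNIV. (x i - 1) * (norm (v $ i))\<^sup>2) \<le> 0"
    by (simp add: algebra_simps sum_subtractf)
  then have "v = 0" using assms by (intro vec_eq_0_if_sum_le[of "\<lambda>i. x i - 1"]) auto
  with v(1) show False ..
qed

lemma pdet_of_real: "pdet S (\<lambda>i. complex_of_real (x i)) \<in> \<real>"
  using pdet_cnj[of S "\<lambda>i. complex_of_real (x i)"] by (simp add: Reals_cnj_iff)

text \<open>By induction the determinant is affine in \<open>x i\<close> with positive slope. Were
  it nonpositive, raising \<open>x i\<close> would reach a zero at a point still above 1, against
  \<open>pdet_real_nonzero\<close>.\<close>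

lemma pdet_pos:
  assumes "\<And>i. x i > 1"
  shows "Re (pdet S (\<lambda>i. complex_of_real (x i))) > 0"
  using finite[of S] assms
proof (induction S arbitrary: x rule: finite_induct)
  case (insert i S)
  let ?c = "\<lambda>x. \<lambda>i. complex_of_real (x i)"
  have eq: "Re (pdet (insert i S) (?c (x(i := x i + h)))) = Re (pdet (insert i S) (?c x)) + h * Re (pdet S (?c x))" for h
  proof -
    have "?c (x(i := x i + h)) = (?c x)(i := ?c x i + complex_of_real h)" by auto
    moreover have "insert i S - {i} = S" using insert by auto
    ultimately show ?thesis using pdet_bump[of i "insert i S" "?c x" "complex_of_real h"] by simp
  qed
  have p: "Re (pdet S (?c x)) > 0" using insert by blast
  show ?case
  proof (rule ccontr)
    assume "\<not> ?thesis"
    then have n: "Re (pdet (insert i S) (?c x)) \<le> 0" by simp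
    define h where "h = - Re (pdet (insert i S) (?c x)) / Re (pdet S (?c x))"
    have "h \<ge> 0" using n p by (simp add: h_def divide_nonpos_pos)
    have "Re (pdet (insert i S) (?c (x(i := x i + h)))) = 0"
      using p by (simp only: eq) (simp add: h_def)
    then have "pdet (insert i S) (?c (x(i := x i + h))) = 0"
      using pdet_of_real[of "insert i S"] by (metis Reals_cases Re_complex_of_real of_real_0)
    moreover have "\<And>j. (x(i := x i + h)) j > 1" using insert.prems \<open>h \<ge> 0\<close> by (simp add: add_strict_increasing2 add.commute)
    ultimately show False using pdet_real_nonzero by blast
  qed
qed simp

end

section \<open>Real-rooted polynomials and interlacing\<close>

abbreviation linear_prod :: "('i \<Rightarrow> 'a::comm_ring_1) \<Rightarrow> 'i set \<Rightarrow> 'a poly" where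
  "linear_prod c I \<equiv> (\<Prod>l\<in>I. [:- c l, 1:])"

lemma degree_linear_prod [simp]: "degree (linear_prod c I) = card I" for c :: "'i \<Rightarrow> 'a::idom"
  by (subst degree_prod_sum_eq) auto

lemma coeff_linear_prod_card [simp]: "coeff (linear_prod c I) (card I) = 1" for c :: "'i \<Rightarrow> 'a::idom"
  using lead_coeff_prod[of "\<lambda>l. [:- c l, 1:]" I] by simp

lemma coeff_linear_prod_pred:
  fixes c :: "'i \<Rightarrow> 'a::idom"
  assumes "finite I" "card I = Suc n"
  shows "coeff (linear_prod c I) n = - (\<Sum>l\<in>I. c l)"
  using assms
proof (induction I arbitrary: n rule: finite_induct)
  case (insert i I)
  then have n: "card I = n" by simp
  show ?case
  proof (cases n)
    case 0
    then show ?thesis using insert n by simp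
  next
    case (Suc m)
    have "coeff (linear_prod c I) n = 1" using coeff_linear_prod_card[of c I] n by simp
    moreover have "coeff (linear_prod c I) m = - (\<Sum>l\<in>I. c l)" using insert.IH Suc n by simp
    ultimately show ?thesis using insert Suc by simp
  qed
qed simp

lemma poly_linear_prod: "poly (linear_prod c I) x = (\<Prod>l\<in>I. x - c l)"
  by (simp add: poly_prod)

text \<open>By Vieta this coefficient is minus the leading one times the sum of the roots, and all
  roots lie strictly below the real axis.\<close>

lemma penultimate_coeff_nonzero:
  fixes p :: "complex poly"
  assumes deg: "degree p = Suc n" and nz: "\<And>X. Im X \<ge> 0 \<Longrightarrow> poly p X \<noteq> 0"
  shows "coeff p n \<noteq> 0"
proof -
  obtain c where c: "smult (lead_coeff p) (linear_prod c {..<degree p}) = p"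
    using complex_poly_decompose' by blast
  have "coeff (smult (lead_coeff p) (linear_prod c {..<degree p})) n = lead_coeff p * - (\<Sum>l<Suc n. c l)"
    using coeff_linear_prod_pred[of "{..<Suc n}" n c] deg by (simp del: sum.lessThan_Suc prod.lessThan_Suc)
  then have eq: "coeff p n = lead_coeff p * - (\<Sum>l<Suc n. c l)" unfolding c .
  have "Im (c l) < 0" if "l < Suc n" for l
  proof (rule ccontr)
    assume "\<not> Im (c l) < 0"
    then have "poly p (c l) \<noteq> 0" using nz by simp
    moreover have "poly (smult (lead_coeff p) (linear_prod c {..<degree p})) (c l) = 0"
      using that deg by (auto simp: poly_linear_prod simp del: prod.lessThan_Suc)
    ultimately show False unfolding c by simp
  qed
  then have "(\<Sum>l<Suc n. Im (c l)) < 0" by (intro sum_strict_mono[where g = "\<lambda>_. 0", simplified]) auto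
  then have "(\<Sum>l<Suc n. c l) \<noteq> 0" by (metis Im_sum less_irrefl zero_complex.sel(2))
  moreover have "p \<noteq> 0" using deg by auto
  ultimately show ?thesis unfolding eq by (simp only: mult_eq_0_iff neg_equal_0_iff_equal leading_coeff_0_iff) simp
qed

abbreviation cpoly :: "real poly \<Rightarrow> complex poly" where
  "cpoly \<equiv> map_poly complex_of_real"

lemma cpoly_mult: "cpoly (p * q) = cpoly p * cpoly q"
  by (simp add: poly_eq_iff coeff_map_poly coeff_mult)

lemma cpoly_smult: "cpoly (smult c q) = smult (complex_of_real c) (cpoly q)"
  by (simp add: poly_eq_iff coeff_map_poly)

lemma cpoly_pCons: "cpoly (pCons c q) = pCons (complex_of_real c) (cpoly q)"
  by (simp add: poly_eq_iff coeff_map_poly coeff_pCons split: nat.split)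

lemma cpoly_prod: "cpoly (\<Prod>l\<in>I. f l) = (\<Prod>l\<in>I. cpoly (f l))"
  by (induction I rule: infinite_finite_induct) (auto simp: cpoly_mult)

lemma cpoly_linear_prod: "cpoly (linear_prod c I) = linear_prod (\<lambda>l. complex_of_real (c l)) I"
  by (simp add: cpoly_prod cpoly_pCons)

lemma poly_cpoly_of_real: "poly (cpoly p) (complex_of_real x) = complex_of_real (poly p x)"
  by (induction p) (auto simp: cpoly_pCons)

lemma cnj_poly_cpoly: "cnj (poly (cpoly p) X) = poly (cpoly p) (cnj X)"
  by (induction p) (auto simp: cpoly_pCons)

lemma cpoly_eq_iff: "cpoly p = cpoly q \<longleftrightarrow> p = q"
  by (auto simp: poly_eq_iff coeff_map_poly)

lemma degree_cpoly [simp]: "degree (cpoly p) = degree p"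
  by (rule degree_map_poly) simp

lemma Im_of_real_mult: "Im (complex_of_real r * z) = r * Im z"
  by simp

text \<open>Nonreal roots of a real polynomial come in conjugate pairs, so a zero-free upper half
  plane leaves only real roots.\<close>

lemma real_rooted_factorization:
  fixes u :: "real poly"
  assumes "\<And>X. Im X > 0 \<Longrightarrow> poly (cpoly u) X \<noteq> 0"
  obtains c where "u = smult (lead_coeff u) (linear_prod c {..<degree u})"
proof -
  obtain c where c: "smult (lead_coeff (cpoly u)) (linear_prod c {..<degree (cpoly u)}) = cpoly u"
    using complex_poly_decompose' by blast
  have im: "Im (c l) = 0" if "l < degree u" for l
  proof (rule ccontr)
    have "poly (smult (lead_coeff (cpoly u)) (linear_prod c {..<degree (cpoly u)})) (c l) = 0"
      using that by (auto simp: poly_linear_prod)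
    then have z: "poly (cpoly u) (c l) = 0" unfolding c .
    then have z': "poly (cpoly u) (cnj (c l)) = 0"
      by (metis cnj_poly_cpoly complex_cnj_zero)
    assume "Im (c l) \<noteq> 0"
    then have "Im (c l) > 0 \<or> Im (cnj (c l)) > 0" by auto
    then show False using assms z z' by blast
  qed
  then have cr: "c l = complex_of_real (Re (c l))" if "l < degree u" for l
    using that by (simp add: complex_eq_iff)
  have "cpoly (smult (lead_coeff u) (linear_prod (\<lambda>l. Re (c l)) {..<degree u})) = cpoly u"
    unfolding cpoly_smult cpoly_linear_prod using c cr by (simp add: coeff_map_poly)
  then show ?thesis using that by (simp only: cpoly_eq_iff) metis
qed

text \<open>Near \<open>c\<close> the quotient \<open>B / ((x - c)^m u)\<close> behaves like a multiple of \<open>(x - c)^(-m)\<close>, which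
  takes arguments of both signs on the upper half plane as soon as \<open>m \<ge> 2\<close>.\<close>

lemma half_plane_simple_pole:
  fixes u B :: "real poly"
  assumes im: "\<And>X. Im X > 0 \<Longrightarrow>
      Im (poly (cpoly B) X * cnj ((X - complex_of_real c) ^ m * poly (cpoly u) X)) \<le> 0"
    and nz: "poly B c \<noteq> 0" "poly u c \<noteq> 0" and m: "m \<ge> 1"
  shows "m = 1 \<and> poly B c * poly u c > 0"
proof -
  define b where "b = poly B c * poly u c"
  have b0: "b \<noteq> 0" using nz by (simp add: b_def)
  \<comment> \<open>Let \<open>X\<close> tend to \<open>c\<close> along the ray of angle
    \<open>t\<close>: after cancelling \<open>e ^ m\<close> the hypothesis becomes
    \<open>G e \<le> 0\<close>, and the limit is \<open>- b sin (m t)\<close>.\<close>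
  have key: "b * sin (real m * t) \<ge> 0" if t: "0 < t" "t < pi" for t
  proof -
    define G where "G = (\<lambda>e::real. Im (poly (cpoly B) (complex_of_real c + of_real e * cis t) *
       cnj (poly (cpoly u) (complex_of_real c + of_real e * cis t)) * cnj (cis (real m * t))))"
    have le: "G e \<le> 0" if "e > 0" for e
    proof -
      let ?X = "complex_of_real c + of_real e * cis t"
      have pos: "Im ?X > 0" using that t by (simp add: sin_gt_zero)
      have "(?X - complex_of_real c) ^ m = of_real (e ^ m) * cis (real m * t)"
        by (simp add: power_mult_distrib Complex.DeMoivre)
      then have "poly (cpoly B) ?X * cnj ((?X - complex_of_real c) ^ m * poly (cpoly u) ?X)
        = of_real (e ^ m) * (poly (cpoly B) ?X * cnj (poly (cpoly u) ?X) * cnj (cis (real m * t)))"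
        by (simp del: of_real_power add: mult_ac)
      then have "Im (of_real (e ^ m) * (poly (cpoly B) ?X * cnj (poly (cpoly u) ?X) * cnj (cis (real m * t)))) \<le> 0"
        using im[OF pos] by (simp only:)
      then have "e ^ m * G e \<le> 0" unfolding G_def by (simp only: Im_of_real_mult)
      moreover have "e ^ m > 0" using that by simp
      ultimately show ?thesis by (simp add: mult_le_0_iff)
    qed
    have "(G \<longlongrightarrow> G 0) (at_right 0)"
      unfolding G_def by (intro tendsto_intros isCont_tendsto_compose[OF poly_isCont] tendsto_eq_intros) auto
    moreover have "eventually (\<lambda>e. G e \<le> 0) (at_right 0)"
      using le by (auto simp: eventually_at_right_less eventually_at_filter intro: always_eventually)
    ultimately have "G 0 \<le> 0" by (rule tendsto_upperbound) simp
    moreover have "G 0 = - (b * sin (real m * t))"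
      by (simp add: G_def poly_cpoly_of_real b_def del: of_real_mult add: of_real_mult[symmetric])
    ultimately show ?thesis by simp
  qed
  have m1: "m = 1"
  proof (rule ccontr)
    assume "m \<noteq> 1"
    then have m2: "real m \<ge> 2" using m by simp
    \<comment> \<open>For \<open>m \<ge> 2\<close> both \<open>pi / (2 m)\<close> and
      \<open>3 pi / (2 m)\<close> lie below \<open>pi\<close>; their sines 1 and -1 force
      contradictory signs of \<open>b\<close>.\<close>
    have "b * sin (real m * (pi / (2 * real m))) \<ge> 0"
      using m2 by (intro key) (auto simp: field_simps)
    then have "b \<ge> 0" using m2 by (simp add: sin_pi_half)
    have "b * sin (real m * (3 * pi / (2 * real m))) \<ge> 0"
      using m2 by (intro key) (auto simp: field_simps)
    moreover have "sin (real m * (3 * pi / (2 * real m))) = -1"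
    proof -
      have "real m * (3 * pi / (2 * real m)) = pi / 2 + pi" using m2 by (simp add: field_simps)
      then show ?thesis by (simp only: sin_periodic_pi sin_pi_half)
    qed
    ultimately show False using \<open>b \<ge> 0\<close> b0 by simp
  qed
  moreover have "b * sin (real m * (pi / 2)) \<ge> 0" by (intro key) auto
  ultimately show ?thesis using b0 unfolding b_def by (metis less_eq_real_def mult_1 of_nat_1 sin_pi_half mult.right_neutral)
qed

text \<open>The hypothesis says that \<open>B / linear_prod c I\<close> maps the upper half plane
  into the closed lower one, which makes its partial fraction weights nonnegative. Common roots are
  cancelled by induction; without them \<open>half_plane_simple_pole\<close> makes every pole simple
  with positive residue.\<close>

lemma interlacing_cone:
  fixes c :: "'i \<Rightarrow> real" and B :: "real poly"
  assumes "finite I" "degree B \<le> card I"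
    and "\<And>X. Im X > 0 \<Longrightarrow> Im (poly (cpoly B) X * cnj (poly (cpoly (linear_prod c I)) X)) \<le> 0"
  shows "\<exists>a w. (\<forall>l\<in>I. w l \<ge> 0) \<and>
    B = smult a (linear_prod c I) + (\<Sum>l\<in>I. smult (w l) (linear_prod c (I - {l})))"
  using assms
proof (induction "card I" arbitrary: I B)
  case 0
  then have "I = {}" by simp
  moreover obtain a where "B = [:a:]" using 0 by (metis degree_eq_zeroE le_zero_eq)
  ultimately show ?case by (intro exI[of _ a]) simp
next
  case (Suc n)
  show ?case
  proof (cases "\<exists>l\<in>I. poly B (c l) = 0")
    case True
    then obtain l where l: "l \<in> I" "poly B (c l) = 0" by blast
    then obtain B' where B': "B = [:- c l, 1:] * B'" by (auto simp: poly_eq_0_iff_dvd)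
    have u: "linear_prod c I = [:- c l, 1:] * linear_prod c (I - {l})"
      using l Suc.prems by (simp add: prod.remove)
    have cI: "card (I - {l}) = n" using l Suc by simp
    have "degree B' \<le> n"
    proof (cases "B' = 0")
      case False
      then have "degree B = Suc (degree B')" unfolding B' by (subst degree_mult_eq) auto
      then show ?thesis using Suc by simp
    qed simp
    \<comment> \<open>The cancelled factor contributes the positive real \<open>|X - c l|^2\<close>,
      so the half-plane condition passes to the quotient.\<close>
    moreover have "Im (poly (cpoly B') X * cnj (poly (cpoly (linear_prod c (I - {l}))) X)) \<le> 0" if X: "Im X > 0" for X
    proof -
      let ?d = "X - complex_of_real (c l)"
      have "poly (cpoly B) X * cnj (poly (cpoly (linear_prod c I)) X) =
        of_real ((norm ?d)\<^sup>2) * (poly (cpoly B') X * cnj (poly (cpoly (linear_prod c (I - {l}))) X))"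
        unfolding B' u cpoly_mult poly_mult complex_norm_square
        by (simp add: cpoly_pCons algebra_simps)
      then have "(norm ?d)\<^sup>2 * Im (poly (cpoly B') X * cnj (poly (cpoly (linear_prod c (I - {l}))) X)) \<le> 0"
        using Suc.prems(3)[OF X] by simp
      moreover have "norm ?d > 0" using X by (auto simp: complex_eq_iff)
      ultimately show ?thesis by (simp add: mult_le_0_iff)
    qed
    ultimately obtain a w where aw: "\<forall>m\<in>I - {l}. w m \<ge> 0"
      "B' = smult a (linear_prod c (I - {l})) + (\<Sum>m\<in>I - {l}. smult (w m) (linear_prod c (I - {l} - {m})))"
      using Suc.hyps(1)[of "I - {l}" B'] cI Suc.prems(1) by auto
    define w' where "w' = w(l := 0)"
    have "[:- c l, 1:] * (\<Sum>m\<in>I - {l}. smult (w m) (linear_prod c (I - {l} - {m}))) =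
      (\<Sum>m\<in>I - {l}. smult (w' m) (linear_prod c (I - {m})))"
      unfolding sum_distrib_left
    proof (rule sum.cong)
      fix m assume m: "m \<in> I - {l}"
      have "linear_prod c (I - {m}) = [:- c l, 1:] * linear_prod c (I - {m} - {l})"
        using l m Suc.prems by (subst prod.remove[of _ l]) auto
      also have "I - {m} - {l} = I - {l} - {m}" by auto
      finally show "[:- c l, 1:] * smult (w m) (linear_prod c (I - {l} - {m})) = smult (w' m) (linear_prod c (I - {m}))"
        using m by (simp only: mult_smult_right) (simp add: w'_def)
    qed simp
    also have "\<dots> = (\<Sum>m\<in>I. smult (w' m) (linear_prod c (I - {m})))"
      using l Suc.prems by (subst (2) sum.remove[of _ l]) (auto simp: w'_def)
    finally have "B = smult a (linear_prod c I) + (\<Sum>m\<in>I. smult (w' m) (linear_prod c (I - {m})))"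
      unfolding B' u aw(2) by (simp only: distrib_left mult_smult_right)
    moreover have "\<forall>m\<in>I. w' m \<ge> 0" using aw(1) by (auto simp: w'_def)
    ultimately show ?thesis by blast
  next
    case False
    have loc: "card {j \<in> I. c j = c l} = 1 \<and> poly B (c l) * poly (linear_prod c {j \<in> I. c j \<noteq> c l}) (c l) > 0"
      if l: "l \<in> I" for l
    proof (rule half_plane_simple_pole)
      show "poly B (c l) \<noteq> 0" using False l by blast
      show "poly (linear_prod c {j \<in> I. c j \<noteq> c l}) (c l) \<noteq> 0"
        using Suc.prems(1) by (auto simp: poly_linear_prod)
      have "{j \<in> I. c j = c l} \<noteq> {}" using l by auto
      then show "1 \<le> card {j \<in> I. c j = c l}"
        using Suc.prems(1) by (simp add: Suc_le_eq card_gt_0_iff)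
      fix X assume X: "Im X > 0"
      have "poly (cpoly (linear_prod c I)) X = (\<Prod>j\<in>I. X - complex_of_real (c j))"
        by (simp add: cpoly_linear_prod poly_linear_prod)
      also have "\<dots> = (\<Prod>j\<in>{j \<in> I. c j = c l}. X - complex_of_real (c j)) * (\<Prod>j\<in>{j \<in> I. c j \<noteq> c l}. X - complex_of_real (c j))"
        using Suc.prems(1) by (subst prod.union_disjoint[symmetric]) (auto intro!: prod.cong)
      also have "(\<Prod>j\<in>{j \<in> I. c j = c l}. X - complex_of_real (c j)) = (X - complex_of_real (c l)) ^ card {j \<in> I. c j = c l}"
        by simp
      also have "(\<Prod>j\<in>{j \<in> I. c j \<noteq> c l}. X - complex_of_real (c j)) = poly (cpoly (linear_prod c {j \<in> I. c j \<noteq> c l})) X"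
        by (simp add: cpoly_linear_prod poly_linear_prod)
      finally show "Im (poly (cpoly B) X * cnj ((X - complex_of_real (c l)) ^ card {j \<in> I. c j = c l} *
          poly (cpoly (linear_prod c {j \<in> I. c j \<noteq> c l})) X)) \<le> 0"
        using Suc.prems(3)[OF X] by simp
    qed
    have inj: "j = l" if jl: "j \<in> I" "l \<in> I" "c j = c l" for j l
    proof -
      obtain k where "{j \<in> I. c j = c l} = {k}" using loc[OF jl(2)] card_1_singletonE by blast
      then have "j \<in> {k}" "l \<in> {k}" using jl by (metis (mono_tags, lifting) mem_Collect_eq)+
      then show ?thesis by simp
    qed
    have rest: "{j \<in> I. c j \<noteq> c l} = I - {l}" if "l \<in> I" for l using inj that by blast
    define v where "v = (\<lambda>l. poly (linear_prod c (I - {l})) (c l))"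
    define w where "w = (\<lambda>l. poly B (c l) / v l)"
    define a where "a = coeff B (card I)"
    have wp: "w l > 0" if "l \<in> I" for l
      using loc[OF that] rest[OF that] by (auto simp: w_def v_def zero_less_divide_iff zero_less_mult_iff)
    have v0: "v l \<noteq> 0" if "l \<in> I" for l
      using wp[OF that] by (auto simp: w_def)
    have dl: "degree (linear_prod c (I - {l})) < card I" if "l \<in> I" for l
      using card_Diff1_less[OF Suc.prems(1) that] by simp
    \<comment> \<open>Lagrange interpolation: both sides agree at the \<open>card I\<close> distinct
      roots and in the coefficient of degree \<open>card I\<close>.\<close>
    have "B = smult a (linear_prod c I) + (\<Sum>l\<in>I. smult (w l) (linear_prod c (I - {l})))"
    proof (rule poly_eqI_degree_lead_coeff[of _ "card I" _ "c ` I"])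
      have "inj_on c I" using inj by (auto intro: inj_onI)
      then show "card I \<le> card (c ` I)" by (simp add: card_image)
      have "coeff (linear_prod c (I - {l})) (card I) = 0" if "l \<in> I" for l
        using dl[OF that] by (rule coeff_eq_0)
      then show "coeff B (card I) = coeff (smult a (linear_prod c I) + (\<Sum>l\<in>I. smult (w l) (linear_prod c (I - {l})))) (card I)"
        by (simp add: coeff_sum a_def)
      show "degree B \<le> card I" by fact
      show "degree (smult a (linear_prod c I) + (\<Sum>l\<in>I. smult (w l) (linear_prod c (I - {l})))) \<le> card I"
      proof (intro degree_add_le degree_sum_le Suc.prems(1))
        show "degree (smult a (linear_prod c I)) \<le> card I"
          by (metis degree_linear_prod degree_smult_le)
        show "degree (smult (w l) (linear_prod c (I - {l}))) \<le> card I" if "l \<in> I" for l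
          using dl[OF that] degree_smult_le[of "w l" "linear_prod c (I - {l})"] by linarith
      qed
      fix z assume "z \<in> c ` I"
      then obtain k where k: "k \<in> I" "z = c k" by blast
      have "(\<Sum>l\<in>I. w l * poly (linear_prod c (I - {l})) z) = w k * v k"
      proof (subst sum.remove[OF Suc.prems(1) k(1)])
        have "(\<Sum>l\<in>I - {k}. w l * poly (linear_prod c (I - {l})) z) = 0"
          using k Suc.prems(1) by (intro sum.neutral) (auto simp: poly_linear_prod)
        then show "w k * poly (linear_prod c (I - {k})) z + (\<Sum>l\<in>I - {k}. w l * poly (linear_prod c (I - {l})) z) = w k * v k"
          using k by (simp add: v_def)
      qed
      also have "\<dots> = poly B z" using v0 k by (simp add: w_def)
      finally show "poly B z = poly (smult a (linear_prod c I) + (\<Sum>l\<in>I. smult (w l) (linear_prod c (I - {l})))) z"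
        using k Suc.prems(1) by (simp add: poly_sum) (auto simp: poly_linear_prod)
    qed
    then show ?thesis using wp less_imp_le by blast
  qed
qed


text \<open>With \<open>d = (n + 1) \<delta>\<close>, the expression
  \<open>coeff p n - d * coeff p (Suc n)\<close> is, up to a factorial, the \<open>n\<close>-th
  derivative of \<open>p\<close> at \<open>- \<delta>\<close>. The claim is linear in
  \<open>B\<close>, so \<open>interlacing_cone\<close> reduces it to generators: \<open>u\<close>
  gives equality, and \<open>u / (x - c l)\<close> needs exactly the hypothesis on
  \<open>d\<close>.\<close>

lemma shifted_penultimate_ratio:
  fixes c :: "'i \<Rightarrow> real" and u B :: "real poly"
  assumes fin: "finite I" and card: "card I = Suc n" and u: "u = smult e (linear_prod c I)" and e: "e > 0"
    and neg: "\<And>l. l \<in> I \<Longrightarrow> c l < 0" and deg: "degree B \<le> Suc n"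
    and im: "\<And>X. Im X > 0 \<Longrightarrow> Im (poly (cpoly B) X * cnj (poly (cpoly u) X)) \<le> 0"
    and d: "\<And>l. l \<in> I \<Longrightarrow> d \<le> (\<Sum>m\<in>I - {l}. - c m)"
  shows "(coeff B n - d * coeff B (Suc n)) * poly u 0 \<le> (coeff u n - d * coeff u (Suc n)) * poly B 0"
proof -
  let ?p = "linear_prod c I" and ?v = "\<lambda>l. linear_prod c (I - {l})"
  have "Im (poly (cpoly B) X * cnj (poly (cpoly ?p) X)) \<le> 0" if "Im X > 0" for X
  proof -
    have "poly (cpoly B) X * cnj (poly (cpoly u) X) = of_real e * (poly (cpoly B) X * cnj (poly (cpoly ?p) X))"
      by (simp add: u cpoly_smult mult_ac)
    then have "e * Im (poly (cpoly B) X * cnj (poly (cpoly ?p) X)) \<le> 0"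
      using im[OF that] by (simp only: Im_of_real_mult)
    then show ?thesis using e by (simp add: mult_le_0_iff)
  qed
  then obtain a w where w: "\<And>l. l \<in> I \<Longrightarrow> w l \<ge> 0" and B: "B = smult a ?p + (\<Sum>l\<in>I. smult (w l) (?v l))"
    using interlacing_cone[OF fin, of B c] deg card by auto
  define P where "P = (\<lambda>l. poly (?v l) 0)"
  define L where "L = (\<Sum>l\<in>I. - c l) - d"
  have Pp: "P l > 0" for l unfolding P_def poly_linear_prod using neg by (intro prod_pos) auto
  have v: "coeff (?v l) n = 1" "coeff (?v l) (Suc n) = 0" if "l \<in> I" for l
  proof -
    have "card (I - {l}) = n" using that card by simp
    then show "coeff (?v l) n = 1" "coeff (?v l) (Suc n) = 0"
      using coeff_linear_prod_card[of c "I - {l}"] by (simp, intro coeff_eq_0, simp)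
  qed
  have p: "coeff ?p n - d * coeff ?p (Suc n) = L"
    using coeff_linear_prod_card[of c I] coeff_linear_prod_pred[OF fin card, of c] card
    by (simp add: L_def sum_negf)
  have p0: "poly ?p 0 = - c l * P l" if "l \<in> I" for l
    using that fin by (simp add: P_def poly_linear_prod prod.remove)
  have "coeff B n - d * coeff B (Suc n) = a * L + (\<Sum>l\<in>I. w l)"
    using v by (simp add: B coeff_sum p[symmetric] algebra_simps)
  moreover have "poly B 0 = a * poly ?p 0 + (\<Sum>l\<in>I. w l * P l)"
    by (simp add: B poly_sum P_def)
  moreover have "(\<Sum>l\<in>I. w l) * poly ?p 0 \<le> L * (\<Sum>l\<in>I. w l * P l)"
    unfolding sum_distrib_right sum_distrib_left
  proof (rule sum_mono)
    fix l assume l: "l \<in> I"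
    have "- c l \<le> L" using d[OF l] l fin by (simp add: L_def sum.remove)
    then have "w l * P l * (- c l) \<le> w l * P l * L"
      using w[OF l] Pp[of l] by (intro mult_left_mono) (auto simp: less_imp_le)
    then show "w l * poly ?p 0 \<le> L * (w l * P l)" using p0[OF l] by (simp add: mult_ac)
  qed
  ultimately have "(coeff B n - d * coeff B (Suc n)) * poly ?p 0 \<le> L * poly B 0"
    by (simp add: algebra_simps)
  then have "e * ((coeff B n - d * coeff B (Suc n)) * poly ?p 0) \<le> e * (L * poly B 0)"
    using e by (intro mult_left_mono) auto
  then show ?thesis unfolding u p[symmetric] by (simp add: algebra_simps)
qed

section \<open>Mixed determinants and stability\<close>

text \<open>Where \<open>b\<close> is nonzero, \<open>g / b\<close> maps the upper half plane into
  its closure. The product with the conjugate avoids dividing by a \<open>b\<close> that may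
  vanish.\<close>

definition upper_pair :: "(complex \<Rightarrow> complex) \<Rightarrow> (complex \<Rightarrow> complex) \<Rightarrow> bool" where
  "upper_pair g b \<longleftrightarrow> g holomorphic_on UNIV \<and> b holomorphic_on UNIV \<and>
     (\<forall>s. g (complex_of_real s) \<in> \<real> \<and> b (complex_of_real s) \<in> \<real>) \<and>
     (\<forall>s. Im s \<ge> 0 \<longrightarrow> Im (g s * cnj (b s)) \<ge> 0)"

lemma Re_has_real_derivative:
  assumes "(g has_field_derivative g') (at (complex_of_real s))"
  shows "((\<lambda>t. Re (g (complex_of_real t))) has_real_derivative Re g') (at s)"
proof -
  have "((\<lambda>t. g (complex_of_real t)) has_vector_derivative g') (at s)"
    using assms by (rule has_vector_derivative_real_field)
  then show ?thesis
    by (auto simp: has_real_derivative_iff_has_vector_derivative intro: bounded_linear.has_vector_derivative[OF bounded_linear_Re])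
qed

text \<open>\<open>Im (g * cnj b)\<close> vanishes at a real point and is nonnegative above it, so
  its vertical derivative, which is the Wronskian, is nonnegative.\<close>

lemma upper_pair_wronskian:
  assumes "upper_pair g b"
  shows "Re (deriv g (complex_of_real s)) * Re (b (complex_of_real s)) -
         Re (g (complex_of_real s)) * Re (deriv b (complex_of_real s)) \<ge> 0"
proof (rule ccontr)
  let ?s = "complex_of_real s"
  have g: "(g has_field_derivative deriv g ?s) (at ?s)" and b: "(b has_field_derivative deriv b ?s) (at ?s)"
    using assms by (auto simp: upper_pair_def intro!: holomorphic_derivI[of _ UNIV])
  have line: "((\<lambda>e. ?s + \<i> * complex_of_real e) has_vector_derivative \<i>) (at 0)"
    by (auto intro!: derivative_eq_intros)
  have gv: "((\<lambda>e. g (?s + \<i> * complex_of_real e)) has_vector_derivative \<i> * deriv g ?s) (at 0)"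
    using field_vector_diff_chain_at[OF line, of g "deriv g ?s"] g by (simp add: o_def)
  have bv: "((\<lambda>e. b (?s + \<i> * complex_of_real e)) has_vector_derivative \<i> * deriv b ?s) (at 0)"
    using field_vector_diff_chain_at[OF line, of b "deriv b ?s"] b by (simp add: o_def)
  define f where "f = (\<lambda>e::real. Im (g (?s + \<i> * of_real e) * cnj (b (?s + \<i> * of_real e))))"
  have "((\<lambda>e. g (?s + \<i> * of_real e) * cnj (b (?s + \<i> * of_real e))) has_vector_derivative
      (g ?s * cnj (\<i> * deriv b ?s) + \<i> * deriv g ?s * cnj (b ?s))) (at 0)"
    using has_vector_derivative_mult[OF gv bounded_linear.has_vector_derivative[OF bounded_linear_cnj bv]] by simp
  then have "(f has_real_derivative Im (g ?s * cnj (\<i> * deriv b ?s) + \<i> * deriv g ?s * cnj (b ?s))) (at 0)"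
    unfolding f_def has_real_derivative_iff_has_vector_derivative
    by (rule bounded_linear.has_vector_derivative[OF bounded_linear_Im])
  moreover have r: "Im (g ?s) = 0" "Im (b ?s) = 0"
    using assms by (auto simp: upper_pair_def complex_is_Real_iff)
  ultimately have D: "(f has_real_derivative (Re (deriv g ?s) * Re (b ?s) - Re (g ?s) * Re (deriv b ?s))) (at 0)"
    by (simp add: algebra_simps)
  assume "\<not> ?thesis"
  then obtain d where d: "d > 0" "\<And>h. 0 < h \<Longrightarrow> h < d \<Longrightarrow> f (0 + h) < f 0"
    using DERIV_neg_dec_right[OF D] by fastforce
  have "f (d / 2) < f 0" using d(2)[of "d / 2"] d(1) by simp
  moreover have "f 0 = 0" using r by (simp add: f_def)
  moreover have "f (d / 2) \<ge> 0" unfolding f_def using assms d(1) by (auto simp: upper_pair_def)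
  ultimately show False by simp
qed

lemma upper_pair_mono:
  assumes up: "upper_pair g b" and le: "s \<le> t"
    and pos: "\<And>r. s \<le> r \<Longrightarrow> r \<le> t \<Longrightarrow> Re (b (complex_of_real r)) > 0"
  shows "Re (g (complex_of_real s)) * Re (b (complex_of_real t)) \<le> Re (g (complex_of_real t)) * Re (b (complex_of_real s))"
proof -
  let ?g = "\<lambda>r. Re (g (complex_of_real r))" and ?b = "\<lambda>r. Re (b (complex_of_real r))"
  have D: "(?g has_real_derivative Re (deriv g (complex_of_real r))) (at r)"
    "(?b has_real_derivative Re (deriv b (complex_of_real r))) (at r)" for r
    using up by (auto simp: upper_pair_def intro!: Re_has_real_derivative holomorphic_derivI[of _ UNIV])
  have "?g s / ?b s \<le> ?g t / ?b t"
  proof (rule DERIV_nonneg_imp_nondecreasing[OF le])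
    fix r assume r: "s \<le> r" "r \<le> t"
    have "((\<lambda>r. ?g r / ?b r) has_real_derivative
      (Re (deriv g (complex_of_real r)) * ?b r - ?g r * Re (deriv b (complex_of_real r))) / (?b r * ?b r)) (at r)"
      using pos[OF r] by (intro DERIV_divide D) auto
    moreover have "(Re (deriv g (complex_of_real r)) * ?b r - ?g r * Re (deriv b (complex_of_real r))) / (?b r * ?b r) \<ge> 0"
      using upper_pair_wronskian[OF up, of r] by (intro divide_nonneg_nonneg) auto
    ultimately show "\<exists>y. ((\<lambda>r. ?g r / ?b r) has_real_derivative y) (at r) \<and> 0 \<le> y" by blast
  qed
  then show ?thesis using pos[of s] pos[of t] le by (simp add: field_simps)
qed

lemma continuous_Re_of_real:
  assumes "g holomorphic_on UNIV"
  shows "continuous_on S (\<lambda>s. Re (g (complex_of_real s)))"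
  by (intro continuous_on_Re continuous_on_compose2[OF holomorphic_on_imp_continuous_on[OF assms]] continuous_intros) auto

text \<open>Let \<open>z\<close> be the last point from \<open>s\<close> on with
  \<open>b \<le> 0\<close>. To the right of \<open>z\<close> the quotient \<open>g / b\<close> is
  nondecreasing, yet it would tend to infinity towards \<open>z\<close>, because \<open>g\<close> is
  positive there.\<close>

lemma upper_pair_pos:
  assumes up: "upper_pair g b" and g: "\<And>r. r \<ge> s \<Longrightarrow> Re (g (complex_of_real r)) > 0"
    and b: "\<And>r. r > M \<Longrightarrow> Re (b (complex_of_real r)) > 0"
  shows "Re (b (complex_of_real s)) > 0"
proof (rule ccontr)
  let ?g = "\<lambda>r. Re (g (complex_of_real r))" and ?b = "\<lambda>r. Re (b (complex_of_real r))"
  assume "\<not> ?b s > 0"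
  have cont: "continuous_on S ?g" "continuous_on S ?b" for S
    using up by (auto simp: upper_pair_def intro: continuous_Re_of_real)
  define Z where "Z = {s..M} \<inter> ?b -` {..0}"
  have "s \<in> Z" using \<open>\<not> ?b s > 0\<close> b[of s] by (force simp: Z_def)
  moreover have "compact Z" unfolding Z_def
    using cont continuous_on_closed_vimage[of "{s..M}"] by (auto intro!: compact_Int_closed simp: Int_commute
      continuous_closed_preimage[of "{s..M}" ?b "{..0}"] compact_eq_bounded_closed intro: bounded_subset[of "{s..M}"])
  ultimately obtain z where z: "z \<in> Z" "\<And>y. y \<in> Z \<Longrightarrow> y \<le> z"
    using compact_attains_sup[of Z] by blast
  have zb: "?b z \<le> 0" "z \<ge> s" using z by (auto simp: Z_def)
  have bp: "?b r > 0" if "r > z" for r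
    using z(2)[of r] that b[of r] z(1) by (force simp: Z_def)
  have ev: "eventually (\<lambda>r. ?g r * ?b (z + 1) \<le> ?g (z + 1) * ?b r) (at_right z)"
  proof (rule eventually_at_rightI[of z "z + 1"])
    fix r assume "r \<in> {z<..<z + 1}"
    then show "?g r * ?b (z + 1) \<le> ?g (z + 1) * ?b r"
      using bp by (intro upper_pair_mono[OF up]) auto
  qed simp
  have tg: "(?g \<longlongrightarrow> ?g z) (at_right z)" and tb: "(?b \<longlongrightarrow> ?b z) (at_right z)"
    using cont[of UNIV] by (simp_all add: continuous_on_eq_continuous_at isCont_def filterlim_at_split)
  have "?g z * ?b (z + 1) \<le> ?g (z + 1) * ?b z"
    by (rule tendsto_le[OF _ tendsto_mult_left[OF tb] tendsto_mult_right[OF tg] ev]) simp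
  also have "\<dots> \<le> 0" using g[of "z + 1"] zb by (simp add: mult_nonneg_nonpos)
  finally show False using g[of z] zb bp[of "z + 1"] by (simp add: mult_le_0_iff)
qed

section \<open>Sums of products of principal determinants over block assignments\<close>

definition bump :: "'r set \<Rightarrow> 'n \<Rightarrow> complex \<Rightarrow> ('r \<Rightarrow> 'n \<Rightarrow> complex) \<Rightarrow> 'r \<Rightarrow> 'n \<Rightarrow> complex" where
  "bump K i h z = (\<lambda>k j. if k \<in> K \<and> j = i then z k j + h else z k j)"

text \<open>Deleting \<open>i\<close> from a block is what differentiation in the variable of that
  block and index does to a product of principal determinants.\<close>

definition drop_from :: "'r set \<Rightarrow> 'n \<Rightarrow> ('r \<Rightarrow> 'n set) \<Rightarrow> 'r \<Rightarrow> 'n set" where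
  "drop_from K i S = (\<lambda>k. if k \<in> K then S k - {i} else S k)"

lemma bump_empty [simp]: "bump {} i h z = z"
  by (simp add: bump_def fun_eq_iff)

lemma drop_from_empty [simp]: "drop_from {} i S = S"
  by (simp add: drop_from_def fun_eq_iff)

lemma bump_insert: "k \<notin> K \<Longrightarrow> bump (insert k K) i h z = bump {k} i h (bump K i h z)"
  by (auto simp: bump_def fun_eq_iff)

lemma drop_from_insert: "drop_from (insert k K) i S = drop_from K i (drop_from {k} i S)"
  by (auto simp: drop_from_def fun_eq_iff)

context psd_contractive
begin

text \<open>\<open>S\<close> holds the indices already assigned, the list those still to be
  distributed. Separate variables \<open>z k j\<close> for each block make the sum affine in every
  one of them.\<close>

primrec mixed :: "'n list \<Rightarrow> ('r::finite \<Rightarrow> 'n set) \<Rightarrow> ('r \<Rightarrow> 'n \<Rightarrow> complex) \<Rightarrow> complex" where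
  "mixed [] S z = (\<Prod>k\<in>UNIV. pdet (S k) (z k))"
| "mixed (i # is) S z = (\<Sum>k\<in>UNIV. mixed is (S(k := insert i (S k))) z)"

lemma mixed_bump:
  assumes "i \<notin> set is" "i \<in> S k"
  shows "mixed is S (bump {k} i h z) = mixed is S z + h * mixed is (drop_from {k} i S) z"
  using assms
proof (induction "is" arbitrary: S)
  case Nil
  have bk: "bump {k} i h z k = (z k)(i := z k i + h)" by (auto simp: bump_def fun_eq_iff)
  have "(\<Prod>l\<in>UNIV. pdet (S l) (bump {k} i h z l)) = pdet (S k) (bump {k} i h z k) * (\<Prod>l\<in>UNIV - {k}. pdet (S l) (z l))"
    by (subst prod.remove[of _ k]) (auto simp: bump_def intro!: prod.cong)
  also have "\<dots> = (pdet (S k) (z k) + h * pdet (S k - {i}) (z k)) * (\<Prod>l\<in>UNIV - {k}. pdet (S l) (z l))"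
    using Nil by (simp add: pdet_bump bk)
  also have "(\<Prod>l\<in>UNIV - {k}. pdet (S l) (z l)) = (\<Prod>l\<in>UNIV - {k}. pdet (drop_from {k} i S l) (z l))"
    by (intro prod.cong) (auto simp: drop_from_def)
  also have "(pdet (S k) (z k) + h * pdet (S k - {i}) (z k)) * \<dots> =
     pdet (S k) (z k) * (\<Prod>l\<in>UNIV - {k}. pdet (drop_from {k} i S l) (z l)) +
     h * (pdet (S k - {i}) (z k) * (\<Prod>l\<in>UNIV - {k}. pdet (drop_from {k} i S l) (z l)))"
    by (simp add: algebra_simps)
  also have "pdet (S k - {i}) (z k) * (\<Prod>l\<in>UNIV - {k}. pdet (drop_from {k} i S l) (z l)) = mixed [] (drop_from {k} i S) z"
    by (simp add: prod.remove[of UNIV k] drop_from_def)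
  also have "pdet (S k) (z k) * (\<Prod>l\<in>UNIV - {k}. pdet (drop_from {k} i S l) (z l)) = mixed [] S z"
    by (simp add: prod.remove[of UNIV k] drop_from_def)
  finally show ?case by simp
next
  case (Cons j "is")
  have "drop_from {k} i (S(l := insert j (S l))) = (drop_from {k} i S)(l := insert j (drop_from {k} i S l))" for l
    using Cons.prems by (auto simp: drop_from_def fun_eq_iff)
  moreover have "i \<in> (S(l := insert j (S l))) k" for l using Cons.prems by auto
  ultimately show ?case using Cons by (simp add: sum.distrib sum_distrib_left del: fun_upd_apply)
qed

lemma mixed_bump_absent:
  assumes "i \<notin> set is" "i \<notin> S k"
  shows "mixed is S (bump {k} i h z) = mixed is S z"
  using assms
proof (induction "is" arbitrary: S)
  case Nil
  have "pdet (S l) (bump {k} i h z l) = pdet (S l) (z l)" for l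
    using Nil by (intro pdet_cong) (auto simp: bump_def)
  then show ?case by simp
next
  case (Cons j "is")
  have "i \<notin> (S(l := insert j (S l))) k" for l using Cons.prems by auto
  then show ?case using Cons by (simp del: fun_upd_apply)
qed

text \<open>The variable of block \<open>k\<close> and index \<open>i\<close> occurs only in the
  summand that puts \<open>i\<close> into block \<open>k\<close>; differentiating there removes
  \<open>i\<close> again.\<close>

lemma mixed_Cons_bump:
  assumes "i \<notin> set is" "i \<notin> S k"
  shows "mixed (i # is) S (bump {k} i h z) = mixed (i # is) S z + h * mixed is S z"
proof -
  have "mixed is (S(l := insert i (S l))) (bump {k} i h z) =
    mixed is (S(l := insert i (S l))) z + (if l = k then h * mixed is S z else 0)" for l
  proof (cases "l = k")
    case True
    have "drop_from {k} i (S(k := insert i (S k))) = S"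
      using assms by (auto simp: drop_from_def fun_eq_iff)
    then show ?thesis using True assms by (simp add: mixed_bump)
  qed (use assms in \<open>simp add: mixed_bump_absent\<close>)
  then show ?thesis by (simp add: sum.distrib)
qed

text \<open>Taylor expansion of a multiaffine polynomial: each \<open>L\<close> lists the variables
  differentiated in.\<close>

lemma mixed_bump_set:
  assumes "finite K" "\<And>k. k \<in> K \<Longrightarrow> i \<in> S k" "i \<notin> set is"
  shows "mixed is S (bump K i h z) = (\<Sum>L\<in>Pow K. h ^ card L * mixed is (drop_from L i S) z)"
  using assms
proof (induction K arbitrary: S rule: finite_induct)
  case (insert k K)
  have inj: "inj_on (insert k) (Pow K)"
    using insert(2) by (intro inj_onI) (metis PowD insert_ident subsetD)
  have "mixed is S (bump (insert k K) i h z) =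
    mixed is S (bump K i h z) + h * mixed is (drop_from {k} i S) (bump K i h z)"
    unfolding bump_insert[OF insert(2)] using insert
    by (subst mixed_bump) (auto simp: mixed_bump)
  also have "mixed is S (bump K i h z) = (\<Sum>L\<in>Pow K. h ^ card L * mixed is (drop_from L i S) z)"
    using insert by simp
  also have "mixed is (drop_from {k} i S) (bump K i h z) =
    (\<Sum>L\<in>Pow K. h ^ card L * mixed is (drop_from L i (drop_from {k} i S)) z)"
    using insert by (intro insert.IH) (auto simp: drop_from_def)
  also have "h * \<dots> = (\<Sum>L\<in>Pow K. h ^ card (insert k L) * mixed is (drop_from (insert k L) i S) z)"
    unfolding sum_distrib_left
  proof (rule sum.cong)
    fix L assume "L \<in> Pow K"
    then have "k \<notin> L" "finite L" using insert by (auto intro: finite_subset)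
    then show "h * (h ^ card L * mixed is (drop_from L i (drop_from {k} i S)) z) =
       h ^ card (insert k L) * mixed is (drop_from (insert k L) i S) z"
      by (simp add: drop_from_insert[symmetric])
  qed simp
  also have "\<dots> = (\<Sum>L\<in>insert k ` Pow K. h ^ card L * mixed is (drop_from L i S) z)"
    by (subst sum.reindex[OF inj]) simp
  finally show ?case
    unfolding Pow_insert using insert by (subst sum.union_disjoint) auto
qed simp

lemma mixed_holomorphic:
  assumes "\<And>k i. (\<lambda>s. z s k i) holomorphic_on U"
  shows "(\<lambda>s. mixed is S (z s)) holomorphic_on U"
  using assms by (induction "is" arbitrary: S) (auto intro!: holomorphic_intros pdet_holomorphic)

lemma mixed_cnj: "mixed is S (\<lambda>k i. cnj (z k i)) = cnj (mixed is S z)"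
  by (induction "is" arbitrary: S) (auto simp: pdet_cnj)

lemma mixed_of_real: "mixed is S (\<lambda>k i. complex_of_real (x k i)) \<in> \<real>"
  using mixed_cnj[of "is" S "\<lambda>k i. complex_of_real (x k i)"] by (simp add: Reals_cnj_iff)

definition rmixed :: "'n list \<Rightarrow> ('r::finite \<Rightarrow> 'n set) \<Rightarrow> ('r \<Rightarrow> 'n \<Rightarrow> real) \<Rightarrow> real" where
  "rmixed is S x = Re (mixed is S (\<lambda>k i. complex_of_real (x k i)))"

lemma of_real_rmixed: "complex_of_real (rmixed is S x) = mixed is S (\<lambda>k i. complex_of_real (x k i))"
  using mixed_of_real[of "is" S x] by (simp add: rmixed_def)

lemma rmixed_Cons: "rmixed (i # is) S x = (\<Sum>k\<in>UNIV. rmixed is (S(k := insert i (S k))) x)"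
  by (simp add: rmixed_def)

lemma rmixed_large:
  assumes "\<And>k i. x k i > 1"
  shows "rmixed is S x > 0"
proof (induction "is" arbitrary: S)
  case Nil
  have "complex_of_real (rmixed [] S x) = (\<Prod>k\<in>UNIV. complex_of_real (Re (pdet (S k) (\<lambda>i. complex_of_real (x k i)))))"
    using pdet_of_real by (simp add: of_real_rmixed)
  also have "\<dots> = complex_of_real (\<Prod>k\<in>UNIV. Re (pdet (S k) (\<lambda>i. complex_of_real (x k i))))"
    by simp
  finally have "rmixed [] S x = (\<Prod>k\<in>UNIV. Re (pdet (S k) (\<lambda>i. complex_of_real (x k i))))"
    by (simp only: of_real_eq_iff)
  then show ?case using pdet_pos assms by (simp add: prod_pos)
qed (auto simp: rmixed_Cons intro!: sum_pos)

lemma card_compl: "card (- L) = CARD('r) - card L" for L :: "'r::finite set"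
  by (simp only: Compl_eq_Diff_UNIV card_Diff_subset[OF finite subset_UNIV])

text \<open>For \<open>i\<close> in every block, this is the polynomial in a common shift of the
  variables of \<open>i\<close>, given by its Taylor coefficients.\<close>

definition block_poly :: "'n list \<Rightarrow> ('r::finite \<Rightarrow> 'n set) \<Rightarrow> 'n \<Rightarrow> ('r \<Rightarrow> 'n \<Rightarrow> complex) \<Rightarrow> complex poly" where
  "block_poly is S i z = (\<Sum>L\<in>UNIV. monom (mixed is (drop_from L i S) z) (card L))"

lemma poly_block_poly:
  assumes "\<And>k. i \<in> S k" "i \<notin> set is"
  shows "poly (block_poly is S i z) h = mixed is S (bump UNIV i h z)"
  using assms by (simp add: mixed_bump_set block_poly_def poly_sum poly_monom mult.commute)

lemma coeff_block_poly:
  "coeff (block_poly is S i z) m = (\<Sum>L | card L = m. mixed is (drop_from L i S) z)"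
  by (simp add: block_poly_def coeff_sum sum.If_cases)

lemma coeff_block_poly_top:
  "coeff (block_poly is S i z) CARD('r) = mixed is (drop_from UNIV i S) z" for S :: "'r::finite \<Rightarrow> 'n set"
proof -
  have "{L :: 'r set. card L = CARD('r)} = {UNIV}" by (auto dest: card_subset_eq[OF finite subset_UNIV])
  then show ?thesis by (simp add: coeff_block_poly)
qed

lemma degree_block_poly: "degree (block_poly is S i z) \<le> CARD('r)" for S :: "'r::finite \<Rightarrow> 'n set"
  unfolding block_poly_def
  by (intro degree_sum_le) (auto intro!: order_trans[OF degree_monom_le card_mono])

lemma coeff_block_poly_1:
  "coeff (block_poly is S i z) 1 = (\<Sum>k\<in>UNIV. mixed is (drop_from {k} i S) z)" for S :: "'r::finite \<Rightarrow> 'n set"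
proof -
  have "{L :: 'r set. card L = 1} = (\<lambda>k. {k}) ` UNIV" by (auto simp: card_1_singleton_iff)
  then show ?thesis unfolding coeff_block_poly by (simp add: sum.reindex)
qed

text \<open>Dropping \<open>i\<close> from all blocks but one amounts to assigning it to that one.
  Hence distributing \<open>i\<close> over \<open>r\<close> blocks is, up to a factorial, the
  \<open>(r - 1)\<close>-st derivative in its common shift.\<close>

lemma coeff_block_poly_penultimate:
  fixes S :: "'r::finite \<Rightarrow> 'n set"
  assumes "\<And>k. i \<in> S k"
  shows "coeff (block_poly is S i z) (CARD('r) - 1) = mixed (i # is) (drop_from UNIV i S) z"
proof -
  have "{L :: 'r set. card L = CARD('r) - 1} = (\<lambda>k. - {k}) ` UNIV"
  proof (intro set_eqI iffI)
    fix L :: "'r set" assume "L \<in> {L. card L = CARD('r) - 1}"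
    then have "card (- L) = 1" using card_compl[of L] by (simp add: Suc_leI)
    then obtain k where "- L = {k}" by (rule card_1_singletonE)
    then show "L \<in> (\<lambda>k. - {k}) ` UNIV" by blast
  qed (auto simp: card_compl)
  moreover have "inj (\<lambda>k::'r. - {k})" by (auto simp: inj_def)
  moreover have "drop_from (- {k}) i S = (drop_from UNIV i S)(k := insert i (drop_from UNIV i S k))" for k
    using assms by (auto simp: drop_from_def fun_eq_iff)
  ultimately show ?thesis unfolding coeff_block_poly by (simp add: sum.reindex)
qed

lemma coeff_block_poly_0: "coeff (block_poly is S i z) 0 = mixed is S z" for S :: "'r::finite \<Rightarrow> 'n set"
proof -
  have "{L :: 'r set. card L = 0} = {{}}" using finite[where 'a = 'r] by (auto simp: card_eq_0_iff)
  then show ?thesis by (simp add: coeff_block_poly)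
qed

text \<open>Put \<open>i\<close> into every block and take the polynomial in its common shift. By
  induction it has full degree and no root in the closed upper half plane, so its penultimate
  coefficient, the sum in question, is nonzero.\<close>

lemma mixed_stable:
  fixes S :: "'r::finite \<Rightarrow> 'n set"
  assumes "distinct is" "\<And>k. S k \<inter> set is = {}" "\<And>k i. Im (z k i) > 0"
  shows "mixed is S z \<noteq> 0"
  using assms
proof (induction "is" arbitrary: S z)
  case (Cons i "is")
  define T where "T = (\<lambda>k. insert i (S k))"
  have TS: "drop_from UNIV i T = S" using Cons.prems(2) by (auto simp: T_def drop_from_def fun_eq_iff)
  let ?p = "block_poly is T i z"
  have top: "coeff ?p CARD('r) \<noteq> 0"
    unfolding coeff_block_poly_top TS using Cons by auto
  obtain n where n: "CARD('r) = Suc n" using zero_less_card_finite gr0_implies_Suc by blast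
  have "degree ?p = Suc n" using degree_block_poly[of "is" T i z] le_degree[OF top] n by simp
  moreover have "poly ?p X \<noteq> 0" if "Im X \<ge> 0" for X
  proof -
    have "mixed is T (bump UNIV i X z) \<noteq> 0"
      using Cons.prems that by (intro Cons.IH) (auto simp: T_def bump_def add_pos_nonneg)
    then show ?thesis using Cons.prems by (simp add: poly_block_poly T_def)
  qed
  ultimately have "coeff ?p n \<noteq> 0" by (rule penultimate_coeff_nonzero)
  then show ?case using coeff_block_poly_penultimate[of i T "is" z] n TS by (simp add: T_def)
qed (auto simp: pdet_upper_nonzero)

end

section \<open>Interlacing and the choice of blocks\<close>

text \<open>The logarithmic derivative at 0; it turns a potential into a sum of reciprocal
  roots.\<close>

lemma coeff_linear_prod_1:
  fixes c :: "'i \<Rightarrow> real"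
  assumes "finite I" "\<And>l. l \<in> I \<Longrightarrow> c l \<noteq> 0"
  shows "coeff (linear_prod c I) 1 = poly (linear_prod c I) 0 * (\<Sum>l\<in>I. 1 / (- c l))"
proof -
  have "coeff (linear_prod c I) 1 = poly (pderiv (linear_prod c I)) 0"
    by (simp add: poly_0_coeff_0 coeff_pderiv)
  also have "\<dots> = (\<Sum>l\<in>I. poly (linear_prod c (I - {l})) 0)"
    by (simp add: pderiv_prod poly_sum pderiv_pCons)
  also have "\<dots> = (\<Sum>l\<in>I. poly (linear_prod c I) 0 * (1 / (- c l)))"
    using assms by (intro sum.cong) (auto simp: poly_linear_prod prod.remove[of I])
  finally show ?thesis by (simp only: sum_distrib_left)
qed

lemma even_poly_pos_at_bot:
  fixes q :: "real poly"
  assumes "even (degree q)" "lead_coeff q > 0"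
  obtains h where "h \<le> c" "poly q h > 0"
proof -
  let ?p = "pcompose q [:0, -1:]"
  have "lead_coeff ?p = lead_coeff q" using assms(1) by (simp add: lead_coeff_comp)
  then obtain n where n: "\<And>x. x \<ge> n \<Longrightarrow> poly ?p x \<ge> lead_coeff q"
    using poly_pinfty_gt_lc[of ?p] assms(2) by auto
  have "poly q (- max n (- c)) > 0"
    using n[of "max n (- c)"] assms(2) by (simp add: poly_pcompose)
  then show ?thesis using that[of "- max n (- c)"] by simp
qed

lemma drop_from_singleton_Compl:
  "k \<notin> K \<Longrightarrow> drop_from {k} i (drop_from (- insert k K) i S) = drop_from (- K) i S"
  by (auto simp: drop_from_def fun_eq_iff)

context psd_contractive
begin

lemma mixed_cong:
  assumes "\<And>k j. j \<in> S k \<or> j \<in> set is \<Longrightarrow> z k j = w k j"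
  shows "mixed is S z = mixed is S w"
  using assms
proof (induction "is" arbitrary: S)
  case Nil
  have "pdet (S k) (z k) = pdet (S k) (w k)" for k
    using Nil by (intro pdet_cong) auto
  then show ?case by simp
next
  case (Cons i "is")
  have "mixed is (S(k := insert i (S k))) z = mixed is (S(k := insert i (S k))) w" for k
    using Cons.prems by (intro Cons.IH) (auto split: if_splits)
  then show ?case by simp
qed

section \<open>Partial derivatives as interlacers\<close>

definition admissible :: "'n list \<Rightarrow> ('r::finite \<Rightarrow> 'n set) \<Rightarrow> bool" where
  "admissible is S \<longleftrightarrow> distinct is \<and> (\<forall>k. S k \<inter> set is = {})"

text \<open>\<open>mixed js T\<close> is a partial derivative of \<open>mixed is S\<close>. The
  relation covers both ways this arises, dropping \<open>i\<close> from a block and removing it from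
  the list, so that interlacing is shown once.\<close>

definition slope :: "'r \<Rightarrow> 'n \<Rightarrow> 'n list \<Rightarrow> ('r::finite \<Rightarrow> 'n set) \<Rightarrow> 'n list \<Rightarrow> ('r \<Rightarrow> 'n set) \<Rightarrow> bool" where
  "slope k i is S js T \<longleftrightarrow> admissible is S \<and> admissible js T \<and>
     (\<forall>h z. mixed is S (bump {k} i h z) = mixed is S z + h * mixed js T z)"

lemma slope_drop:
  assumes "admissible is S" "i \<in> S k"
  shows "slope k i is S is (drop_from {k} i S)"
proof -
  have "i \<notin> set is" using assms by (auto simp: admissible_def)
  then show ?thesis using assms
    by (auto simp: slope_def mixed_bump admissible_def drop_from_def split: if_splits)
qed

lemma slope_Cons:
  assumes "admissible (i # is) S"
  shows "slope k i (i # is) S is S"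
proof -
  have "i \<notin> S k" "i \<notin> set is" using assms by (auto simp: admissible_def)
  then show ?thesis using assms by (auto simp: slope_def mixed_Cons_bump admissible_def simp del: mixed.simps)
qed

text \<open>With \<open>G\<close> and \<open>B\<close> the two values, shifting only the variable of
  \<open>k\<close> and \<open>i\<close> by \<open>- G / B\<close> gives a zero of
  \<open>mixed is S\<close>. Stability keeps this point out of the open upper half plane, which
  bounds \<open>Im (G / B)\<close> below. Boundary points follow by continuity.\<close>

lemma slope_bound:
  assumes sl: "slope k i is S js T" and z: "\<And>l j. Im (z l j) \<ge> 0"
  shows "Im (z k i) * (norm (mixed js T z))\<^sup>2 \<le> Im (mixed is S z * cnj (mixed js T z))"
proof -
  have op: "Im (w k i) * (norm (mixed js T w))\<^sup>2 \<le> Im (mixed is S w * cnj (mixed js T w))"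
    if w: "\<And>l j. Im (w l j) > 0" for w
  proof (rule ccontr)
    let ?G = "mixed is S w" and ?B = "mixed js T w"
    assume a: "\<not> ?thesis"
    have B0: "?B \<noteq> 0" by (rule mixed_stable) (use sl w in \<open>auto simp: slope_def admissible_def\<close>)
    have eq: "Im (?G / ?B) = Im (?G * cnj ?B) / (norm ?B)\<^sup>2"
      by (subst complex_div_cnj) simp
    have "Im (?G / ?B) < Im (w k i)"
      unfolding eq using a B0 by (simp add: divide_less_eq)
    then have "Im (bump {k} i (- (?G / ?B)) w l j) > 0" for l j
      using w by (auto simp: bump_def)
    then have "mixed is S (bump {k} i (- (?G / ?B)) w) \<noteq> 0"
      using sl by (intro mixed_stable) (auto simp: slope_def admissible_def)
    moreover have "mixed is S (bump {k} i (- (?G / ?B)) w) = 0"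
      using sl B0 by (simp add: slope_def)
    ultimately show False ..
  qed
  define w where "w = (\<lambda>e l j. z l j + \<i> * complex_of_real e)"
  define f where "f = (\<lambda>e. Im (mixed is S (w e) * cnj (mixed js T (w e))) - Im (w e k i) * (norm (mixed js T (w e)))\<^sup>2)"
  have ho: "(\<lambda>s. mixed is S (\<lambda>l j. z l j + \<i> * s)) holomorphic_on UNIV" for "is" S
    by (intro mixed_holomorphic holomorphic_intros)
  have cont: "continuous_on UNIV (\<lambda>e. mixed is S (w e))" for "is" S
    unfolding w_def
    by (rule continuous_on_compose2[OF holomorphic_on_imp_continuous_on[OF ho]]) (auto intro!: continuous_intros)
  have "continuous_on UNIV f" unfolding f_def
    by (intro continuous_intros cont) (auto simp: w_def intro!: continuous_intros)
  then have "(f \<longlongrightarrow> f 0) (at_right 0)"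
    by (simp add: continuous_on_eq_continuous_at isCont_def filterlim_at_split)
  moreover have "eventually (\<lambda>e. f e \<ge> 0) (at_right 0)"
  proof (rule eventually_at_rightI[of 0 1])
    fix e :: real assume "e \<in> {0<..<1}"
    then have "Im (w e l j) > 0" for l j using z[of l j] by (simp add: w_def)
    then show "f e \<ge> 0" using op[of "w e"] by (simp add: f_def)
  qed simp
  ultimately have "f 0 \<ge> 0" by (rule tendsto_lowerbound) simp
  then show ?thesis by (simp add: f_def w_def)
qed

text \<open>Nonnegative directions keep all variables in the closed upper half plane, so
  \<open>slope_bound\<close> applies along the line and the one-variable results become
  available.\<close>

lemma slope_upper_pair:
  assumes "slope k i is S js T" "\<And>l j. v l j \<ge> 0"
  shows "upper_pair (\<lambda>s. mixed is S (\<lambda>l j. complex_of_real (x l j) + s * complex_of_real (v l j)))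
    (\<lambda>s. mixed js T (\<lambda>l j. complex_of_real (x l j) + s * complex_of_real (v l j)))"
  unfolding upper_pair_def
proof (intro conjI allI impI)
  fix s
  have "complex_of_real (x l j) + complex_of_real s * complex_of_real (v l j) = complex_of_real (x l j + s * v l j)" for l j
    by simp
  then show "mixed is S (\<lambda>l j. complex_of_real (x l j) + complex_of_real s * complex_of_real (v l j)) \<in> \<real>"
    "mixed js T (\<lambda>l j. complex_of_real (x l j) + complex_of_real s * complex_of_real (v l j)) \<in> \<real>"
    by (simp_all only: mixed_of_real)
next
  fix s :: complex assume "Im s \<ge> 0"
  then have "Im (complex_of_real (x l j) + s * complex_of_real (v l j)) \<ge> 0" for l j
    using assms(2) by simp
  note bound = slope_bound[OF assms(1), of "\<lambda>l j. complex_of_real (x l j) + s * complex_of_real (v l j)", OF this]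
  have "0 \<le> Im (complex_of_real (x k i) + s * complex_of_real (v k i)) *
     (norm (mixed js T (\<lambda>l j. complex_of_real (x l j) + s * complex_of_real (v l j))))\<^sup>2"
    using \<open>Im s \<ge> 0\<close> assms(2)[of k i] by (intro mult_nonneg_nonneg) auto
  also note bound
  finally show "0 \<le> Im (mixed is S (\<lambda>l j. complex_of_real (x l j) + s * complex_of_real (v l j)) *
      cnj (mixed js T (\<lambda>l j. complex_of_real (x l j) + s * complex_of_real (v l j))))" .
qed (auto intro!: mixed_holomorphic holomorphic_intros)

lemma Re_mixed_line:
  "Re (mixed is S (\<lambda>l j. complex_of_real (x l j) + complex_of_real s * complex_of_real (v l j))) =
   rmixed is S (\<lambda>l j. x l j + s * v l j)"
  by (simp add: rmixed_def)

lemma slope_mono: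
  assumes sl: "slope k i is S js T" and le: "\<And>l j. x l j \<le> y l j"
    and pos: "\<And>s. 0 \<le> s \<Longrightarrow> s \<le> 1 \<Longrightarrow> rmixed js T (\<lambda>l j. x l j + s * (y l j - x l j)) > 0"
  shows "rmixed is S x * rmixed js T y \<le> rmixed is S y * rmixed js T x"
  using upper_pair_mono[OF slope_upper_pair[OF sl, of "\<lambda>l j. y l j - x l j" x], of 0 1] le pos
  unfolding Re_mixed_line by simp

definition pos_above :: "'n list \<Rightarrow> ('r::finite \<Rightarrow> 'n set) \<Rightarrow> ('r \<Rightarrow> 'n \<Rightarrow> real) \<Rightarrow> bool" where
  "pos_above is S x \<longleftrightarrow> (\<forall>y. (\<forall>k j. x k j \<le> y k j) \<longrightarrow> rmixed is S y > 0)"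

text \<open>Along the diagonal direction the derivative is positive far out by
  \<open>rmixed_large\<close>; \<open>upper_pair_pos\<close> carries this back to
  \<open>x\<close>.\<close>

lemma slope_pos:
  assumes sl: "slope k i is S js T" and G: "\<And>s. s \<ge> 0 \<Longrightarrow> rmixed is S (\<lambda>l j. x l j + s) > 0"
  shows "rmixed js T x > 0"
proof -
  let ?m = "Min (range (\<lambda>(l, j). x l j))"
  have ge: "?m \<le> x l j" for l j
    by (rule Min_le) auto
  have "0 < Re (mixed js T (\<lambda>l j. complex_of_real (x l j) + complex_of_real 0 * complex_of_real 1))"
  proof (rule upper_pair_pos[OF slope_upper_pair[OF sl]])
    show "0 < Re (mixed js T (\<lambda>l j. complex_of_real (x l j) + complex_of_real r * complex_of_real 1))"
      if "r > 1 - ?m" for r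
      unfolding Re_mixed_line using that ge by (intro rmixed_large) (smt (verit) mult.right_neutral)
  qed (use G in \<open>auto simp: Re_mixed_line simp del: of_real_1\<close>)
  then show ?thesis unfolding Re_mixed_line by simp
qed

lemma slope_pos_above:
  assumes sl: "slope k i is S js T" and G: "pos_above is S x"
  shows "pos_above js T x"
  unfolding pos_above_def
proof (intro allI impI)
  fix y assume y: "\<forall>k j. x k j \<le> y k j"
  show "rmixed js T y > 0"
    using sl
  proof (rule slope_pos)
    fix s :: real assume "s \<ge> 0"
    then have "\<forall>l j. x l j \<le> y l j + s" using y by (metis add_increasing2)
    then show "rmixed is S (\<lambda>l j. y l j + s) > 0" using G by (simp add: pos_above_def)
  qed
qed

lemma pos_above_drop:
  assumes "admissible is S" "pos_above is S x" "finite K" "\<And>k. k \<in> K \<Longrightarrow> i \<in> S k"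
  shows "pos_above is (drop_from K i S) x \<and> admissible is (drop_from K i S)"
  using assms(3,1,2,4)
proof (induction K arbitrary: S rule: finite_induct)
  case (insert k K)
  have sl: "slope k i is S is (drop_from {k} i S)" using insert by (intro slope_drop) auto
  have "pos_above is (drop_from K i (drop_from {k} i S)) x \<and> admissible is (drop_from K i (drop_from {k} i S))"
  proof (rule insert.IH)
    show "admissible is (drop_from {k} i S)" using sl by (simp add: slope_def)
    show "pos_above is (drop_from {k} i S) x" using sl insert.prems by (blast intro: slope_pos_above)
    show "i \<in> drop_from {k} i S l" if "l \<in> K" for l
      using insert that by (auto simp: drop_from_def)
  qed
  then show ?case by (simp only: drop_from_insert[of k K])
qed simp

text \<open>All summands of \<open>mixed (i # is) S\<close> share the interlacer \<open>mixed is S\<close>: each quotient by it is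
  nondecreasing to the right of the largest root of the interlacer, so the summands cannot all be nonpositive somewhere
  there without their sum being nonpositive as well.\<close>

lemma interlacing_choice:
  assumes adm: "admissible (i # is) S"
    and pos: "\<And>t. t > r \<Longrightarrow> rmixed (i # is) S (\<lambda>_ _. t) > 0"
  shows "\<exists>k. \<forall>t>r. rmixed is (S(k := insert i (S k))) (\<lambda>_ _. t) > 0"
proof (rule ccontr)
  assume "\<not> ?thesis"
  then have "\<forall>k. \<exists>t>r. rmixed is (S(k := insert i (S k))) (\<lambda>_ _. t) \<le> 0" by (simp add: not_less)
  then obtain t where t: "\<And>k. t k > r" "\<And>k. rmixed is (S(k := insert i (S k))) (\<lambda>_ _. t k) \<le> 0"
    by metis
  \<comment> \<open>By monotonicity the smallest of the points \<open>t k\<close> serves for all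
    summands at once.\<close>
  define m where "m = Min (range t)"
  have mt: "m \<le> t k" for k unfolding m_def by (rule Min_le) auto
  have "m \<in> range t" unfolding m_def by (rule Min_in) auto
  then have mr: "m > r" using t(1) by auto
  have c: "rmixed is S (\<lambda>_ _. s) > 0" if "s > r" for s
    using slope_Cons[OF adm, of undefined] by (rule slope_pos) (use pos that in auto)
  have "rmixed is (S(k := insert i (S k))) (\<lambda>_ _. m) \<le> 0" for k
  proof -
    let ?S = "S(k := insert i (S k))"
    have dr: "drop_from {k} i ?S = S" using adm by (auto simp: admissible_def drop_from_def fun_eq_iff)
    have "slope k i is ?S is (drop_from {k} i ?S)"
      using adm by (intro slope_drop) (auto simp: admissible_def)
    then have sl: "slope k i is ?S is S" unfolding dr .
    have "rmixed is ?S (\<lambda>_ _. m) * rmixed is S (\<lambda>_ _. t k) \<le> rmixed is ?S (\<lambda>_ _. t k) * rmixed is S (\<lambda>_ _. m)"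
    proof (rule slope_mono[OF sl])
      fix s :: real assume "0 \<le> s" "s \<le> 1"
      then have "m + s * (t k - m) > r" using mr mt[of k] by (smt (verit) mult_nonneg_nonneg)
      then show "rmixed is S (\<lambda>_ _. m + s * (t k - m)) > 0" by (rule c)
    qed (rule mt)
    also have "\<dots> \<le> 0" using t(2)[of k] c[OF mr] by (simp add: mult_nonpos_nonneg)
    finally show ?thesis using c[OF t(1)[of k]] by (simp add: mult_le_0_iff)
  qed
  then have "rmixed (i # is) S (\<lambda>_ _. m) \<le> 0" unfolding rmixed_Cons by (intro sum_nonpos) auto
  then show False using pos[OF mr] by simp
qed

text \<open>\<open>interlacing_choice\<close> is repeated along the list and \<open>b\<close>
  records the chosen blocks; at the end the sum has become a single product.\<close>

lemma partition_choice:
  fixes S :: "'r::finite \<Rightarrow> 'n set"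
  assumes "admissible is S" "\<And>t. t > r \<Longrightarrow> rmixed is S (\<lambda>_ _. t) > 0"
  shows "\<exists>b::'n \<Rightarrow> 'r. \<forall>t>r. rmixed [] (\<lambda>k. S k \<union> {i \<in> set is. b i = k}) (\<lambda>_ _. t) > 0"
  using assms
proof (induction "is" arbitrary: S)
  case (Cons i "is")
  obtain k where k: "\<forall>t>r. rmixed is (S(k := insert i (S k))) (\<lambda>_ _. t) > 0"
    using interlacing_choice[OF Cons.prems] by blast
  have "admissible is (S(k := insert i (S k)))" using Cons.prems(1) by (auto simp: admissible_def)
  then obtain b where b: "\<forall>t>r. rmixed [] (\<lambda>l. (S(k := insert i (S k))) l \<union> {j \<in> set is. b j = l}) (\<lambda>_ _. t) > 0"
    using Cons.IH k by blast
  have "i \<notin> set is" using Cons.prems(1) by (auto simp: admissible_def)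
  then have "(\<lambda>l. (S(k := insert i (S k))) l \<union> {j \<in> set is. b j = l}) =
     (\<lambda>l. S l \<union> {j \<in> set (i # is). (b(i := k)) j = l})"
    by (intro ext) auto
  with b show ?case by (intro exI[of _ "b(i := k)"]) (simp only:)
qed auto

end

section \<open>The barrier step\<close>

context psd_contractive
begin

abbreviation shift :: "'n \<Rightarrow> real \<Rightarrow> ('r \<Rightarrow> 'n \<Rightarrow> real) \<Rightarrow> 'r \<Rightarrow> 'n \<Rightarrow> real" where
  "shift i h x \<equiv> (\<lambda>k j. if j = i then x k j + h else x k j)"

lemma of_real_shift:
  "(\<lambda>k j. complex_of_real (shift i h x k j)) = bump UNIV i (complex_of_real h) (\<lambda>k j. complex_of_real (x k j))"
  by (auto simp: bump_def fun_eq_iff)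

definition rblock :: "'n list \<Rightarrow> ('r::finite \<Rightarrow> 'n set) \<Rightarrow> 'n \<Rightarrow> ('r \<Rightarrow> 'n \<Rightarrow> real) \<Rightarrow> real poly" where
  "rblock is S i x = (\<Sum>L\<in>UNIV. monom (rmixed is (drop_from L i S) x) (card L))"

lemma cpoly_rblock: "cpoly (rblock is S i x) = block_poly is S i (\<lambda>k j. complex_of_real (x k j))"
  by (simp add: poly_eq_iff coeff_map_poly rblock_def block_poly_def coeff_sum of_real_rmixed[symmetric]
      if_distrib[of complex_of_real] cong: if_cong)

lemma coeff_rblock:
  "complex_of_real (coeff (rblock is S i x) m) = coeff (block_poly is S i (\<lambda>k j. complex_of_real (x k j))) m"
  by (simp add: cpoly_rblock[symmetric] coeff_map_poly)

lemma poly_rblock: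
  assumes "\<And>k. i \<in> S k" "i \<notin> set is"
  shows "poly (rblock is S i x) h = rmixed is S (shift i h x)"
proof -
  have "complex_of_real (poly (rblock is S i x) h) = complex_of_real (rmixed is S (shift i h x))"
    unfolding poly_cpoly_of_real[symmetric] cpoly_rblock of_real_rmixed of_real_shift
    using assms by (rule poly_block_poly)
  then show ?thesis by (simp only: of_real_eq_iff)
qed

lemma coeff_rblock_top:
  "coeff (rblock is S i x) CARD('r) = rmixed is (drop_from UNIV i S) x" for S :: "'r::finite \<Rightarrow> 'n set"
  using coeff_rblock[of "is" S i x "CARD('r)"] unfolding coeff_block_poly_top of_real_rmixed[symmetric] by (simp only: of_real_eq_iff)
    
lemma coeff_rblock_penultimate:
  fixes S :: "'r::finite \<Rightarrow> 'n set"
  assumes "\<And>k. i \<in> S k"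
  shows "coeff (rblock is S i x) (CARD('r) - 1) = rmixed (i # is) (drop_from UNIV i S) x"
  using coeff_rblock[of "is" S i x "CARD('r) - 1"]
  unfolding coeff_block_poly_penultimate[OF assms] of_real_rmixed[symmetric] by (simp only: of_real_eq_iff)

lemma coeff_rblock_1:
  "coeff (rblock is S i x) 1 = (\<Sum>k\<in>UNIV. rmixed is (drop_from {k} i S) x)" for S :: "'r::finite \<Rightarrow> 'n set"
  using coeff_rblock[of "is" S i x 1]
  unfolding coeff_block_poly_1 of_real_rmixed[symmetric] of_real_sum[symmetric] by (simp only: of_real_eq_iff)

lemma coeff_rblock_0: "coeff (rblock is S i x) 0 = rmixed is S x"
  using coeff_rblock[of "is" S i x 0]
  unfolding coeff_block_poly_0 of_real_rmixed[symmetric] by (simp only: of_real_eq_iff)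

lemma degree_rblock: "degree (rblock is S i x) \<le> CARD('r)" for S :: "'r::finite \<Rightarrow> 'n set"
  using degree_block_poly[of "is" S i "\<lambda>k j. complex_of_real (x k j)"] by (simp only: cpoly_rblock[symmetric] degree_cpoly)

lemma degree_rblock_eq:
  fixes S :: "'r::finite \<Rightarrow> 'n set"
  assumes "rmixed is (drop_from UNIV i S) x \<noteq> 0"
  shows "degree (rblock is S i x) = CARD('r)"
  using degree_rblock[of "is" S i x] le_degree[of "rblock is S i x" "CARD('r)"] assms coeff_rblock_top[of "is" S i x] by simp

text \<open>The other variables are real, so \<open>mixed_stable\<close> does not apply directly.
  Start with \<open>i\<close> removed from every block, where the value is nonzero by assumption,
  and restore it block by block: \<open>slope_bound\<close> with \<open>Im X > 0\<close> keeps each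
  stage nonzero.\<close>

lemma block_poly_real_rooted:
  fixes S :: "'r::finite \<Rightarrow> 'n set"
  assumes adm: "admissible is S" and i: "\<And>k. i \<in> S k"
    and nz: "rmixed is (drop_from UNIV i S) x \<noteq> 0" and X: "Im X > 0"
  shows "poly (cpoly (rblock is S i x)) X \<noteq> 0"
proof -
  have iis: "i \<notin> set is" using adm i by (auto simp: admissible_def)
  let ?z = "bump (UNIV :: 'r set) i X (\<lambda>k j. complex_of_real (x k j))"
  have "mixed is (drop_from (- K) i S) ?z \<noteq> 0 \<and> admissible is (drop_from (- K) i S)" for K
    using finite[of K]
  proof (induction K rule: finite_induct)
    case empty
    have "mixed is (drop_from UNIV i S) ?z = mixed is (drop_from UNIV i S) (\<lambda>k j. complex_of_real (x k j))"
      using iis by (intro mixed_cong) (auto simp: drop_from_def bump_def)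
    also have "\<dots> \<noteq> 0" using nz unfolding of_real_rmixed[symmetric] by simp
    moreover have "admissible is (drop_from UNIV i S)" using adm by (auto simp: admissible_def drop_from_def)
    ultimately show ?case by simp
  next
    case (insert k K)
    have ad: "admissible is (drop_from (- insert k K) i S)"
      using adm by (auto simp: admissible_def drop_from_def)
    then have "slope k i is (drop_from (- insert k K) i S) is (drop_from {k} i (drop_from (- insert k K) i S))"
      using i by (intro slope_drop) (auto simp: drop_from_def)
    then have sl: "slope k i is (drop_from (- insert k K) i S) is (drop_from (- K) i S)"
      unfolding drop_from_singleton_Compl[OF insert(2)] .
    have "Im (?z k i) * (norm (mixed is (drop_from (- K) i S) ?z))\<^sup>2 \<le>
       Im (mixed is (drop_from (- insert k K) i S) ?z * cnj (mixed is (drop_from (- K) i S) ?z))"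
      using sl by (rule slope_bound) (use X in \<open>auto simp: bump_def\<close>)
    moreover have "Im (?z k i) * (norm (mixed is (drop_from (- K) i S) ?z))\<^sup>2 > 0"
      using insert X by (auto simp: bump_def)
    ultimately show ?case using ad by auto
  qed
  from this[of UNIV] show ?thesis using poly_block_poly[of i S "is", OF i iis] by (simp add: cpoly_rblock)
qed

section \<open>Nonnegativity of the roots in the variable of one index\<close>

lemma diag_nonneg: "Re (A $ i $ i) \<ge> 0"
proof -
  have "(A *v axis i 1) $ j = A $ j $ i" for j
    by (simp add: matrix_vector_mult_def axis_def if_distrib[of "\<lambda>x. _ * x"] cong: if_cong)
  moreover have "axis i 1 \<bullet> (A *v axis i 1) = 1 \<bullet> ((A *v axis i 1) $ i)"
    by (rule inner_axis')
  ultimately have "axis i 1 \<bullet> (A *v axis i 1) = Re (A $ i $ i)"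
    by (simp add: inner_complex_def)
  then show ?thesis using form_nonneg[of "axis i 1"] by simp
qed

text \<open>If \<open>u c\<close> were nonpositive, monotonicity of \<open>u / b\<close> would keep
  \<open>u\<close> nonpositive to the left of \<open>c\<close>, whereas a polynomial of even degree
  with positive leading coefficient is positive far to the left.\<close>

lemma rmixed_negative_step:
  fixes S T :: "'r::finite \<Rightarrow> 'n set"
  assumes ev: "even CARD('r)"
    and sl: "slope k j is S js T" and i: "\<And>l. i \<in> S l" and pos: "pos_above is S x"
    and B: "\<And>c. c < 0 \<Longrightarrow> rmixed js T (\<lambda>l m. if m = i then c else x l m) > 0" and c: "c < 0"
  shows "rmixed is S (\<lambda>l m. if m = i then c else x l m) > 0"
proof (rule ccontr)
  define u where "u = (\<lambda>c. rmixed is S (\<lambda>l m. if m = i then c else x l m))"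
  define b where "b = (\<lambda>c. rmixed js T (\<lambda>l m. if m = i then c else x l m))"
  assume "\<not> ?thesis"
  then have uc: "u c \<le> 0" by (simp add: u_def)
  have adm: "admissible is S" using sl by (simp add: slope_def)
  then have iis: "i \<notin> set is" using i by (auto simp: admissible_def)
  have neg: "u c' \<le> 0" if c': "c' \<le> c" for c'
  proof -
    have "u c' * b c \<le> u c * b c'"
      unfolding u_def b_def
    proof (rule slope_mono[OF sl])
      fix s :: real assume s: "0 \<le> s" "s \<le> 1"
      have "c' + s * (c - c') = (1 - s) * c' + s * c" by (simp add: algebra_simps)
      also have "\<dots> < 0" using s c c' by (smt (verit) mult_nonneg_nonpos2 mult_pos_neg zero_less_mult_iff mult_nonneg_nonpos)
      finally have neg: "c' + s * (c - c') < 0" .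
      have eq: "(\<lambda>l m. (if m = i then c' else x l m) + s * ((if m = i then c else x l m) - (if m = i then c' else x l m))) =
        (\<lambda>l m. if m = i then c' + s * (c - c') else x l m)" by (auto simp: fun_eq_iff)
      show "rmixed js T (\<lambda>l m. (if m = i then c' else x l m) + s * ((if m = i then c else x l m) - (if m = i then c' else x l m))) > 0"
        unfolding eq using B[OF neg] .
    qed (use c' in auto)
    also have "\<dots> \<le> 0" using uc B[of c'] c c' by (simp add: b_def mult_nonpos_nonneg)
    finally show ?thesis using B[OF c] by (simp add: b_def mult_le_0_iff)
  qed
  let ?x0 = "\<lambda>l m. if m = i then 0 else x l m"
  let ?q = "rblock is S i ?x0"
  have "mixed is (drop_from UNIV i S) (\<lambda>l m. complex_of_real (?x0 l m)) = mixed is (drop_from UNIV i S) (\<lambda>l m. complex_of_real (x l m))"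
    using iis by (intro mixed_cong) (auto simp: drop_from_def)
  then have "rmixed is (drop_from UNIV i S) ?x0 = rmixed is (drop_from UNIV i S) x"
    by (simp add: rmixed_def)
  moreover have "pos_above is (drop_from UNIV i S) x"
    using pos_above_drop[OF adm pos] i by auto
  ultimately have e: "rmixed is (drop_from UNIV i S) ?x0 > 0" by (simp add: pos_above_def)
  then have d: "degree ?q = CARD('r)" by (intro degree_rblock_eq) simp
  moreover have "lead_coeff ?q > 0" using e by (simp only: d coeff_rblock_top)
  ultimately obtain h where h: "h \<le> c" "poly ?q h > 0" using even_poly_pos_at_bot[of ?q c] ev by auto
  have "shift i h ?x0 = (\<lambda>l m. if m = i then h else x l m)" by (auto simp: fun_eq_iff)
  then have "poly ?q h = u h" using poly_rblock[of i S "is" ?x0 h, OF i iis] by (simp add: u_def)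
  then show False using h neg by force
qed

text \<open>Partial derivatives shrink the list and the blocks until only \<open>i\<close> is left
  in every block; the value there is an even power of the negative number
  \<open>c - Re (A $ i $ i)\<close>. \<open>rmixed_negative_step\<close> carries positivity
  back.\<close>

lemma rmixed_negative:
  fixes S :: "'r::finite \<Rightarrow> 'n set"
  assumes ev: "even CARD('r)" and "admissible is S" "\<And>l. i \<in> S l" "pos_above is S x" "c < 0"
  shows "rmixed is S (\<lambda>l m. if m = i then c else x l m) > 0"
  using assms(2-5)
proof (induction "length is + (\<Sum>k\<in>UNIV. card (S k))" arbitrary: "is" S c rule: less_induct)
  case less
  consider j js where "is = j # js" | k j where "is = []" "j \<in> S k" "j \<noteq> i" | "is = []" "\<And>k. S k = {i}"
    using less.prems(2) by (cases "is") blast+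
  then show ?case
  proof cases
    case 1
    have sl: "slope undefined j is S js S" using less.prems(1) unfolding 1 by (rule slope_Cons)
    show ?thesis
      by (rule rmixed_negative_step[OF ev sl less.prems(2,3) _ less.prems(4)])
        (rule less.hyps, use 1 sl less.prems slope_pos_above[OF sl] in \<open>auto simp: slope_def\<close>)
  next
    case (2 k j)
    let ?T = "drop_from {k} j S"
    have sl: "slope k j is S is ?T" using less.prems(1) 2(2) by (rule slope_drop)
    have "(\<Sum>l\<in>UNIV. card (?T l)) < (\<Sum>l\<in>UNIV. card (S l))"
      by (rule sum_strict_mono_ex1) (use 2 card_Diff1_less[OF finite 2(2)] in \<open>auto simp: drop_from_def intro!: card_mono bexI[of _ k]\<close>)
    then show ?thesis
      by (intro rmixed_negative_step[OF ev sl less.prems(2,3) _ less.prems(4)] less.hyps)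
        (use 2 sl less.prems slope_pos_above[OF sl] in \<open>auto simp: slope_def drop_from_def\<close>)
  next
    case 3
    have r: "A $ i $ i = complex_of_real (Re (A $ i $ i))"
      using hermitian_cnj[OF herm, of i i] by (metis Reals_cnj_iff of_real_Re)
    have "complex_of_real (rmixed is S (\<lambda>l m. if m = i then c else x l m)) = (complex_of_real c - A $ i $ i) ^ CARD('r)"
      unfolding of_real_rmixed using 3 by (simp add: pdet_singleton)
    also have "\<dots> = complex_of_real ((c - Re (A $ i $ i)) ^ CARD('r))"
      by (subst r) simp
    finally have "rmixed is S (\<lambda>l m. if m = i then c else x l m) = (c - Re (A $ i $ i)) ^ CARD('r)"
      by (simp only: of_real_eq_iff)
    moreover have "c - Re (A $ i $ i) < 0" using less.prems(4) diag_nonneg[of i] by simp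
    ultimately show ?thesis using ev by (simp add: zero_less_power_eq)
  qed
qed

text \<open>Nonnegative shifts stay in the region of positivity, so the roots are negative. A shift
  below \<open>- t\<close> would make the variables of \<open>i\<close> negative, where
  \<open>rmixed_negative\<close> excludes zeros.\<close>

lemma rblock_roots:
  fixes S :: "'r::finite \<Rightarrow> 'n set" and t :: real
  assumes ev: "even CARD('r)" and adm: "admissible is S" and i: "\<And>l. i \<in> S l"
    and pos: "pos_above is S x" and t: "\<And>k. x k i = t"
  obtains e and c :: "nat \<Rightarrow> real" where "e > 0" "e = rmixed is (drop_from UNIV i S) x" "rblock is S i x = smult e (linear_prod c {..<CARD('r)})"
    "\<forall>l<CARD('r). c l < 0 \<and> - t \<le> c l"
proof -
  let ?u = "rblock is S i x"
  define e where "e = rmixed is (drop_from UNIV i S) x"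
  have iis: "i \<notin> set is" using adm i by (auto simp: admissible_def)
  have "pos_above is (drop_from UNIV i S) x"
    using pos_above_drop[OF adm pos] i by auto
  then have e: "e > 0" by (simp add: pos_above_def e_def)
  then have d: "degree ?u = CARD('r)" unfolding e_def by (intro degree_rblock_eq) simp
  have le: "lead_coeff ?u = e" by (simp only: d coeff_rblock_top e_def)
  have nz: "poly (cpoly ?u) X \<noteq> 0" if "Im X > 0" for X
    by (rule block_poly_real_rooted[OF adm i _ that]) (use e in \<open>simp add: e_def\<close>)
  obtain c where c: "?u = smult (lead_coeff ?u) (linear_prod c {..<degree ?u})"
    by (rule real_rooted_factorization[OF nz])
  then have c: "?u = smult e (linear_prod c {..<CARD('r)})"
    unfolding le unfolding d .
  have "c l < 0 \<and> - t \<le> c l" if "l < CARD('r)" for l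
  proof -
    have z: "rmixed is S (shift i (c l) x) = 0"
      using that by (subst poly_rblock[of i S "is", OF i iis, symmetric], subst c) (auto simp: poly_linear_prod)
    have "c l < 0"
    proof (rule ccontr)
      assume "\<not> c l < 0"
      then have "rmixed is S (shift i (c l) x) > 0"
        by (intro pos[unfolded pos_above_def, rule_format]) auto
      then show False using z by simp
    qed
    moreover have "- t \<le> c l"
    proof (rule ccontr)
      assume "\<not> - t \<le> c l"
      then have "rmixed is S (\<lambda>l' m. if m = i then t + c l else x l' m) > 0"
        by (intro rmixed_negative ev adm i pos) simp
      moreover have "(\<lambda>l' m. if m = i then t + c l else x l' m) = shift i (c l) x"
        using t by (auto simp: fun_eq_iff)
      ultimately show False using z by simp
    qed
    ultimately show ?thesis ..
  qed
  with that e e_def c show ?thesis by blast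
qed

lemma mixed_Cons_bump_set:
  assumes "i \<notin> set is" "\<And>k. i \<notin> S k" "finite K"
  shows "mixed (i # is) S (bump K i h z) = mixed (i # is) S z + of_nat (card K) * h * mixed is S z"
  using assms(3)
proof (induction K rule: finite_induct)
  case (insert k K)
  have "mixed is S (bump K i h z) = mixed is S z"
    using assms by (intro mixed_cong) (auto simp: bump_def)
  then show ?case unfolding bump_insert[OF insert(2)] mixed_Cons_bump[of i "is" S k, OF assms(1,2)] insert.IH
    using insert by (simp add: algebra_simps)
qed simp

lemma rmixed_Cons_shift:
  fixes S :: "'r::finite \<Rightarrow> 'n set"
  assumes "i \<notin> set is" "\<And>k. i \<notin> S k"
  shows "rmixed (i # is) S (shift i h x) = rmixed (i # is) S x + real CARD('r) * h * rmixed is S x"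
proof -
  have "complex_of_real (rmixed (i # is) S (shift i h x)) =
    complex_of_real (rmixed (i # is) S x + real CARD('r) * h * rmixed is S x)"
    unfolding of_real_rmixed of_real_shift using mixed_Cons_bump_set[of i "is" S UNIV, OF assms finite]
    by (simp add: of_real_rmixed del: mixed.simps)
  then show ?thesis by (simp only: of_real_eq_iff)
qed

text \<open>Summing over the block of \<open>i\<close> takes the penultimate coefficient of
  \<open>rblock\<close>, and lowering by \<open>\<delta>\<close> subtracts \<open>d\<close> times
  the top one. The negated roots are at most \<open>t\<close> and their reciprocal sum is bounded by
  the potential, so assumption \<open>shift\<close> supplies the condition on \<open>d\<close> in
  \<open>shifted_penultimate_ratio\<close>.\<close>

lemma barrier_step:
  fixes S :: "'r::finite \<Rightarrow> 'n set" and t \<delta> \<phi> :: real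
  assumes ev: "even CARD('r)" and adm: "admissible is S" and i: "\<And>l. i \<in> S l"
    and pos: "pos_above is S x" and t: "\<And>k. x k i = t"
    and pot: "(\<Sum>k\<in>UNIV. rmixed is (drop_from {k} i S) x) \<le> \<phi> * rmixed is S x"
    and shift: "\<And>s :: nat \<Rightarrow> real. (\<And>l. l < CARD('r) \<Longrightarrow> 0 < s l \<and> s l \<le> t) \<Longrightarrow> (\<Sum>l<CARD('r). 1 / s l) \<le> \<phi> \<Longrightarrow>
        (\<forall>l<CARD('r). real CARD('r) * \<delta> \<le> (\<Sum>m\<in>{..<CARD('r)} - {l}. s m))"
  shows "pos_above (i # is) (drop_from UNIV i S) (shift i (- \<delta>) x)"
    and "\<And>j (\<psi> :: real). j \<noteq> i \<Longrightarrow> (\<And>l. j \<in> S l) \<Longrightarrow>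
      (\<Sum>k\<in>UNIV. rmixed is (drop_from {k} j S) x) \<le> \<psi> * rmixed is S x \<Longrightarrow>
      (\<Sum>k\<in>UNIV. rmixed (i # is) (drop_from {k} j (drop_from UNIV i S)) (shift i (- \<delta>) x))
        \<le> \<psi> * rmixed (i # is) (drop_from UNIV i S) (shift i (- \<delta>) x)"
proof -
  let ?r = "CARD('r)" and ?T = "drop_from UNIV i S"
  let ?I = "{..<?r}"
  define d where "d = real ?r * \<delta>"
  obtain n where n: "?r = Suc n" using zero_less_card_finite gr0_implies_Suc by blast
  have iis: "i \<notin> set is" using adm i by (auto simp: admissible_def)
  have iT: "i \<notin> ?T k" for k by (simp add: drop_from_def)
  obtain e and c :: "nat \<Rightarrow> real" where e: "e > 0" "e = rmixed is ?T x" and u: "rblock is S i x = smult e (linear_prod c ?I)"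
    and c': "\<forall>l<?r. c l < 0 \<and> - t \<le> c l"
    by (rule rblock_roots[of "is" S i x t, OF ev adm i pos t])
  have c: "c l < 0 \<and> - t \<le> c l" if "l < ?r" for l using c' that by blast
  have u0: "rmixed is S x > 0" using pos by (simp add: pos_above_def)
  have pu: "poly (rblock is S i x) 0 = rmixed is S x"
    by (simp add: poly_0_coeff_0 coeff_rblock_0)
  have "rmixed is S x * (\<Sum>l\<in>?I. 1 / (- c l)) = coeff (rblock is S i x) 1"
    unfolding pu[symmetric] u coeff_smult poly_smult
    by (subst coeff_linear_prod_1) (use c in force)+
  also have "\<dots> \<le> \<phi> * rmixed is S x" using pot by (simp only: coeff_rblock_1)
  finally have "(\<Sum>l\<in>?I. 1 / (- c l)) \<le> \<phi>" using u0 by (simp add: mult.commute)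
  with shift[of "\<lambda>l. - c l"] c have d: "d \<le> (\<Sum>m\<in>?I - {l}. - c m)" if "l \<in> ?I" for l
    using that unfolding d_def by fastforce
  have Lx: "rmixed (i # is) ?T x = coeff (rblock is S i x) n"
    using coeff_rblock_penultimate[of i S "is" x] i n by simp
  have Lx': "rmixed is ?T x = coeff (rblock is S i x) (Suc n)"
    using coeff_rblock_top[of "is" S i x] n by simp
  \<comment> \<open>The penultimate coefficient is \<open>e\<close> times the sum of all
    \<open>- c l\<close>. Without \<open>- c 0\<close> the sum is still at least \<open>d\<close>,
    and \<open>- c 0 > 0\<close> gives strictness.\<close>
  have big: "rmixed (i # is) ?T x > d * e"
  proof -
    have "coeff (rblock is S i x) n = e * (\<Sum>l\<in>?I. - c l)"
      unfolding u using coeff_linear_prod_pred[of ?I n c] n by (simp add: sum_negf)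
    moreover have "(\<Sum>l\<in>?I. - c l) = - c 0 + (\<Sum>m\<in>?I - {0}. - c m)"
      using n by (intro sum.remove) auto
    moreover have "- c 0 > 0" using c[of 0] n by simp
    ultimately show ?thesis unfolding Lx using d[of 0] n e(1) by simp
  qed
  have admC: "admissible (i # is) ?T" using adm iis by (auto simp: admissible_def drop_from_def)
  have posT: "pos_above is ?T x" using pos_above_drop[OF adm pos] i by auto
  show "pos_above (i # is) ?T (shift i (- \<delta>) x)"
    unfolding pos_above_def
  proof (intro allI impI)
    fix y assume y: "\<forall>k j. shift i (- \<delta>) x k j \<le> y k j"
    \<comment> \<open>Undoing the shift gives a point above \<open>x\<close>, where the quotient of
      \<open>rmixed (i # is) ?T\<close> by its derivative is at least as large as at
      \<open>x\<close>.\<close>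
    define w where "w = shift i \<delta> y"
    have xw: "x k j \<le> w k j" for k j using y[rule_format, of j k] by (auto simp: w_def split: if_splits)
    have yw: "y = shift i (- \<delta>) w" by (auto simp: w_def fun_eq_iff)
    have Tw: "rmixed is ?T w > 0" using posT xw by (simp add: pos_above_def)
    have "rmixed (i # is) ?T x * rmixed is ?T w \<le> rmixed (i # is) ?T w * rmixed is ?T x"
    proof (rule slope_mono[OF slope_Cons[OF admC] xw])
      fix s :: real assume "0 \<le> s" "s \<le> 1"
      then have "\<forall>l j. x l j \<le> x l j + s * (w l j - x l j)" using xw by simp
      then show "rmixed is ?T (\<lambda>l j. x l j + s * (w l j - x l j)) > 0" using posT by (simp add: pos_above_def)
    qed
    moreover have "d * e * rmixed is ?T w < rmixed (i # is) ?T x * rmixed is ?T w"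
      using big Tw by (intro mult_strict_right_mono)
    ultimately have "e * (d * rmixed is ?T w) < e * rmixed (i # is) ?T w"
      unfolding e(2)[symmetric] by (simp add: mult_ac)
    then have "d * rmixed is ?T w < rmixed (i # is) ?T w" using e(1) by simp
    then show "rmixed (i # is) ?T y > 0"
      unfolding yw rmixed_Cons_shift[of i "is" ?T, OF iis iT] by (simp add: d_def)
  qed
  fix j and \<psi> :: real assume j: "j \<noteq> i" "\<And>l. j \<in> S l"
    and potj: "(\<Sum>k\<in>UNIV. rmixed is (drop_from {k} j S) x) \<le> \<psi> * rmixed is S x"
  let ?B = "\<lambda>k. rblock is (drop_from {k} j S) i x"
  have L: "rmixed (i # is) (drop_from UNIV i V) (shift i (- \<delta>) x) =
     coeff (rblock is V i x) n - d * coeff (rblock is V i x) (Suc n)" if "\<And>k. i \<in> V k" for V :: "'r \<Rightarrow> 'n set"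
  proof -
    have iV: "i \<notin> drop_from UNIV i V k" for k by (simp add: drop_from_def)
    show ?thesis unfolding rmixed_Cons_shift[of i "is" "drop_from UNIV i V", OF iis iV]
      using coeff_rblock_penultimate[of i V "is" x] coeff_rblock_top[of "is" V i x] that n by (simp add: d_def)
  qed
  have comm: "drop_from {k} j ?T = drop_from UNIV i (drop_from {k} j S)" for k
    by (auto simp: drop_from_def fun_eq_iff)
  have iV: "i \<in> drop_from {k} j S l" for k l using i j by (auto simp: drop_from_def)
  let ?L = "\<lambda>p :: real poly. coeff p n - d * coeff p (Suc n)"
  \<comment> \<open>Each block is treated separately: by \<open>slope_bound\<close> the quotient of
    \<open>?B k\<close> by \<open>rblock is S i x\<close> has nonpositive imaginary part on the
    upper half plane.\<close>
  have one: "?L (?B k) * rmixed is S x \<le> ?L (rblock is S i x) * rmixed is (drop_from {k} j S) x" for k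
  proof -
    have sl: "slope k j is S is (drop_from {k} j S)" using adm j(2) by (rule slope_drop)
    have "?L (?B k) * poly (rblock is S i x) 0 \<le> ?L (rblock is S i x) * poly (?B k) 0"
    proof (rule shifted_penultimate_ratio[OF _ _ u e(1) _ _ _ d])
      show "degree (?B k) \<le> Suc n" using degree_rblock[of "is" "drop_from {k} j S" i x] n by simp
      fix X :: complex assume X: "Im X > 0"
      let ?z = "bump (UNIV :: 'r set) i X (\<lambda>k j. complex_of_real (x k j))"
      have zi: "Im (?z l m) \<ge> 0" for l m using X by (auto simp: bump_def)
      have "0 \<le> Im (?z k j) * (norm (mixed is (drop_from {k} j S) ?z))\<^sup>2" using zi by simp
      also have "\<dots> \<le> Im (mixed is S ?z * cnj (mixed is (drop_from {k} j S) ?z))"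
        using sl zi by (rule slope_bound)
      also have "\<dots> = - Im (mixed is (drop_from {k} j S) ?z * cnj (mixed is S ?z))" by simp
      finally show "Im (poly (cpoly (?B k)) X * cnj (poly (cpoly (rblock is S i x)) X)) \<le> 0"
        unfolding cpoly_rblock poly_block_poly[of i "drop_from {k} j S" "is", OF iV iis] poly_block_poly[of i S "is", OF i iis] by simp
    qed (use n c in auto)
    then show ?thesis by (simp add: poly_0_coeff_0 coeff_rblock_0)
  qed
  have Lpos: "?L (rblock is S i x) > 0"
    using big e(2) by (simp add: Lx Lx')
  have "(\<Sum>k\<in>UNIV. ?L (?B k)) * rmixed is S x \<le> ?L (rblock is S i x) * (\<Sum>k\<in>UNIV. rmixed is (drop_from {k} j S) x)"
    unfolding sum_distrib_right sum_distrib_left by (intro sum_mono one)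
  also have "\<dots> \<le> ?L (rblock is S i x) * (\<psi> * rmixed is S x)"
    using potj Lpos by (intro mult_left_mono) auto
  finally have "(\<Sum>k\<in>UNIV. ?L (?B k)) * rmixed is S x \<le> (\<psi> * ?L (rblock is S i x)) * rmixed is S x"
    by (simp only: mult_ac)
  then have "(\<Sum>k\<in>UNIV. ?L (?B k)) \<le> \<psi> * ?L (rblock is S i x)" using u0 by (rule mult_right_le_imp_le)
  then show "(\<Sum>k\<in>UNIV. rmixed (i # is) (drop_from {k} j ?T) (shift i (- \<delta>) x))
        \<le> \<psi> * rmixed (i # is) ?T (shift i (- \<delta>) x)"
    unfolding comm L[of "drop_from {_} j S", OF iV] L[of S, OF i] .
qed

end

section \<open>The paving bound\<close>

text \<open>Testing the form on \<open>r v - B v\<close> yields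
  \<open>|B v|^2 \<le> r (v . B v)\<close>, and the upper bound on the form finishes.\<close>

lemma psd_norm_le:
  fixes B :: "complex ^ 'n ^ 'n"
  assumes B: "hermitian B" and nn: "\<And>w. 0 \<le> w \<bullet> (B *v w)" and le: "\<And>w. w \<bullet> (B *v w) \<le> r * (w \<bullet> w)"
    and r: "r > 0"
  shows "norm (B *v v) \<le> r * norm v"
proof -
  let ?a = "B *v v"
  let ?d = "r *\<^sub>R v - ?a"
  have Bd: "B *v ?d = r *\<^sub>R ?a - B *v ?a"
    by (simp add: matrix_vector_mult_diff_distrib matrix_vector_scaleR)
  have va: "v \<bullet> (B *v ?a) = ?a \<bullet> ?a" using hermitian_inner[OF B, of v ?a] by simp
  have "0 \<le> ?d \<bullet> (B *v ?d)" by (rule nn)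
  also have "\<dots> = r\<^sup>2 * (v \<bullet> ?a) - 2 * r * (?a \<bullet> ?a) + ?a \<bullet> (B *v ?a)"
    unfolding Bd using va by (simp add: inner_diff_left inner_diff_right power2_eq_square algebra_simps)
  also have "\<dots> \<le> r\<^sup>2 * (v \<bullet> ?a) - r * (?a \<bullet> ?a)" using le[of ?a] by simp
  finally have "r * (?a \<bullet> ?a) \<le> r * (r * (v \<bullet> ?a))" by (simp add: power2_eq_square mult.assoc)
  then have "?a \<bullet> ?a \<le> r * (v \<bullet> ?a)" using r by simp
  also have "\<dots> \<le> r * (r * (v \<bullet> v))" using le[of v] r by (intro mult_left_mono) auto
  finally have "(norm ?a)\<^sup>2 \<le> (r * norm v)\<^sup>2"
    by (simp add: dot_square_norm power2_eq_square mult_ac)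
  then show ?thesis using r by (simp add: power2_le_iff_abs_le)
qed

text \<open>Harmonic and arithmetic means, by summing the tangent bound
  \<open>2 c - c^2 / s \<le> s\<close> with \<open>c\<close> the common value in the case of
  equality.\<close>

lemma sum_ge_if_sum_inverse_le:
  fixes s :: "'i \<Rightarrow> real"
  assumes "\<And>m. m \<in> I \<Longrightarrow> s m > 0" "(\<Sum>m\<in>I. 1 / s m) \<le> w" "w > 0"
  shows "(real (card I))\<^sup>2 / w \<le> (\<Sum>m\<in>I. s m)"
proof -
  define c where "c = real (card I) / w"
  have "2 * c - c\<^sup>2 * (1 / s m) \<le> s m" if "m \<in> I" for m
  proof -
    have "0 \<le> (s m - c)\<^sup>2 / s m" using assms(1)[OF that] by simp
    also have "\<dots> = s m - 2 * c + c\<^sup>2 * (1 / s m)"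
      using assms(1)[OF that] by (simp add: field_simps power2_eq_square)
    finally show ?thesis by simp
  qed
  then have "(\<Sum>m\<in>I. 2 * c - c\<^sup>2 * (1 / s m)) \<le> (\<Sum>m\<in>I. s m)" by (rule sum_mono)
  moreover have "(\<Sum>m\<in>I. 2 * c - c\<^sup>2 * (1 / s m)) = 2 * c * card I - c\<^sup>2 * (\<Sum>m\<in>I. 1 / s m)"
    by (simp add: sum_subtractf sum_distrib_left mult_ac)
  moreover have "c\<^sup>2 * (\<Sum>m\<in>I. 1 / s m) \<le> c\<^sup>2 * w" using assms(2) by (intro mult_left_mono) auto
  moreover have "2 * c * card I - c\<^sup>2 * w = (real (card I))\<^sup>2 / w"
    using assms(3) by (simp add: c_def field_simps power2_eq_square)
  ultimately show ?thesis by linarith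
qed

section \<open>Starting point and iteration of the barrier argument\<close>

context psd_contractive
begin

text \<open>The ratio of the determinants is a diagonal entry of the resolvent. On [0,1] the convex
  function \<open>1 / (t - x)\<close> lies below its chord \<open>(t - 1 + x) / (t (t - 1))\<close>;
  this is the operator form of that inequality.\<close>

lemma resolvent_entry_bound:
  assumes t: "t > 1"
  shows "t * (t - 1) * Re (pdet (UNIV - {j}) (\<lambda>_. complex_of_real t)) \<le>
    (t - 1 + Re (A $ j $ j)) * Re (pdet UNIV (\<lambda>_. complex_of_real t))"
proof -
  let ?t = "\<lambda>_ :: 'n. complex_of_real t"
  define p where "p = Re (pdet UNIV ?t)"
  define q where "q = Re (pdet (UNIV - {j}) ?t)"
  have p: "p > 0" and q: "q > 0" unfolding p_def q_def using t by (auto intro!: pdet_pos)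
  have pc: "pdet UNIV ?t = complex_of_real p" "pdet (UNIV - {j}) ?t = complex_of_real q"
    using pdet_of_real[of _ "\<lambda>_. t"] by (simp_all add: p_def q_def)
  \<comment> \<open>Lowering the variable of \<open>j\<close> by \<open>p / q\<close> makes the
    determinant vanish; a kernel vector satisfies \<open>(t - A) v = g v_j e_j\<close>, so it is a
    multiple of column \<open>j\<close> of the resolvent.\<close>
  define g where "g = p / q"
  have g: "g > 0" using p q by (simp add: g_def)
  have "pdet UNIV (?t(j := ?t j + complex_of_real (- g))) =
      pdet UNIV ?t + complex_of_real (- g) * pdet (UNIV - {j}) ?t"
    by (rule pdet_bump) simp
  also have "\<dots> = 0" unfolding pc using q by (simp add: g_def)
  finally have "pdet UNIV (?t(j := ?t j + complex_of_real (- g))) = 0" .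
  then obtain v where v: "v \<noteq> 0"
    "\<And>i. (?t(j := ?t j + complex_of_real (- g))) i * v $ i = (A *v v) $ i"
    by (rule pmat_kernel) auto
  define w where "w = t *\<^sub>R v - A *v v"
  have w: "w = g *\<^sub>R axis j (v $ j)"
    unfolding w_def vec_eq_iff
    by (simp add: v(2)[symmetric] axis_def) (auto simp: scaleR_conv_of_real[where 'a = complex] algebra_simps)
  have vj: "v $ j \<noteq> 0"
  proof
    assume "v $ j = 0"
    then have "t *\<^sub>R v = A *v v" using w unfolding w_def by (simp add: axis_def vec_eq_iff)
    then have "t * (v \<bullet> v) \<le> v \<bullet> v" using form_le[of v] by (metis inner_scaleR_right)
    moreover have "v \<bullet> v > 0" using v(1) by simp
    ultimately show False using t by simp
  qed
  let ?n = "v $ j \<bullet> v $ j"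
  have n: "?n > 0" using vj by simp
  have wv: "w \<bullet> v = g * ?n" unfolding w by (simp add: inner_axis')
  have ww: "w \<bullet> w = g\<^sup>2 * ?n" unfolding w by (simp add: inner_axis' power2_eq_square)
  have "(A *v axis j (v $ j)) $ j = A $ j $ j * v $ j"
    by (simp add: matrix_vector_mult_def axis_def if_distrib[of "\<lambda>x. _ * x"] cong: if_cong)
  moreover have "A $ j $ j = complex_of_real (Re (A $ j $ j))"
    using hermitian_cnj[OF herm, of j j] by (metis Reals_cnj_iff of_real_Re)
  ultimately have "(A *v axis j (v $ j)) $ j = Re (A $ j $ j) *\<^sub>R v $ j"
    by (metis scaleR_conv_of_real)
  then have wAw: "w \<bullet> (A *v w) = g\<^sup>2 * ?n * Re (A $ j $ j)"
    unfolding w by (simp add: matrix_vector_scaleR inner_axis' power2_eq_square)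
  let ?a = "A *v v"
  let ?d = "v - ?a"
  have Ad: "A *v ?d = ?a - A *v ?a" by (simp add: matrix_vector_mult_diff_distrib)
  \<comment> \<open>The identity \<open>(t - 1 + A) (t - A) = t (t - 1) + A (1 - A)\<close>, applied
    to \<open>v\<close>.\<close>
  have "w \<bullet> ((t - 1) *\<^sub>R w + A *v w) = t * (t - 1) * (w \<bullet> v) + w \<bullet> (A *v ?d)"
    unfolding inner_add_right[symmetric] inner_scaleR_right[symmetric] Ad
    by (rule arg_cong[of _ _ "inner w"]) (simp add: w_def matrix_vector_mult_diff_distrib matrix_vector_scaleR algebra_simps)
  \<comment> \<open>Nonnegativity of \<open>(t - A) A (1 - A)\<close>, from splitting
    \<open>t - A\<close> as \<open>(t - 1) + (1 - A)\<close>.\<close>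
  moreover have "w \<bullet> (A *v ?d) \<ge> 0"
  proof -
    have "?a \<bullet> (A *v ?d) \<ge> 0" unfolding Ad using form_le[of ?a] by (simp add: inner_diff_right)
    moreover have d: "?d \<bullet> (A *v ?d) \<ge> 0" by (rule form_nonneg)
    ultimately have "v \<bullet> (A *v ?d) \<ge> 0" by (simp add: inner_diff_left)
    then have "(t - 1) * (v \<bullet> (A *v ?d)) + ?d \<bullet> (A *v ?d) \<ge> 0" using d t by simp
    moreover have "w = (t - 1) *\<^sub>R v + ?d" by (simp add: w_def algebra_simps)
    ultimately show ?thesis by (simp only: inner_add_left inner_scaleR_left)
  qed
  ultimately have "t * (t - 1) * (g * ?n) \<le> (t - 1) * (g\<^sup>2 * ?n) + g\<^sup>2 * ?n * Re (A $ j $ j)"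
    by (simp add: inner_add_right wv ww wAw)
  then have "(g * ?n) * (t * (t - 1)) \<le> (g * ?n) * (g * (t - 1 + Re (A $ j $ j)))"
    by (simp add: algebra_simps power2_eq_square)
  then have "t * (t - 1) \<le> g * (t - 1 + Re (A $ j $ j))" using g n by simp
  then have "t * (t - 1) * q \<le> (t - 1 + Re (A $ j $ j)) * p"
    using q by (simp add: g_def field_simps)
  then show ?thesis by (simp only: p_def q_def)
qed

text \<open>All blocks carry the same determinant \<open>p\<close>, and deleting \<open>j\<close>
  from one turns one factor into \<open>q\<close>; so the potential is the number of blocks times a
  resolvent entry.\<close>

lemma initial_potential:
  fixes j :: 'n
  assumes t: "t > 1" and a: "Re (A $ j $ j) \<le> a"
  shows "(\<Sum>k\<in>(UNIV :: 'r::finite set). rmixed [] (drop_from {k} j (\<lambda>_. UNIV)) (\<lambda>_ _. t)) \<le>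
    real CARD('r) * (a / (t - 1) + (1 - a) / t) * rmixed [] (\<lambda>_ :: 'r. UNIV) (\<lambda>_ _. t)"
proof -
  let ?t = "\<lambda>_ :: 'n. complex_of_real t"
  define p where "p = Re (pdet UNIV ?t)"
  define q where "q = Re (pdet (UNIV - {j}) ?t)"
  have p: "p > 0" unfolding p_def using t by (auto intro!: pdet_pos)
  have pc: "pdet UNIV ?t = complex_of_real p" "pdet (UNIV - {j}) ?t = complex_of_real q"
    using pdet_of_real[of _ "\<lambda>_. t"] by (simp_all add: p_def q_def)
  have "t * (t - 1) * q \<le> (t - 1 + Re (A $ j $ j)) * p"
    using resolvent_entry_bound[OF t] by (simp add: p_def q_def)
  also have "\<dots> \<le> (t - 1 + a) * p" using a p by (intro mult_right_mono) auto
  also have "\<dots> = t * (t - 1) * ((a / (t - 1) + (1 - a) / t) * p)"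
    using t by (simp add: field_simps)
  finally have "q \<le> (a / (t - 1) + (1 - a) / t) * p" using t by simp
  then have "p ^ (CARD('r) - 1) * q \<le> p ^ (CARD('r) - 1) * ((a / (t - 1) + (1 - a) / t) * p)"
    using p by (intro mult_left_mono) auto
  also have "\<dots> = (a / (t - 1) + (1 - a) / t) * p ^ CARD('r)"
    using power_minus_mult[of "CARD('r)" p] zero_less_card_finite[where 'a = 'r] by (simp add: mult_ac)
  finally have le: "p ^ (CARD('r) - 1) * q \<le> (a / (t - 1) + (1 - a) / t) * p ^ CARD('r)" .
  have "rmixed [] (drop_from {k} j (\<lambda>_. UNIV)) (\<lambda>_ _. t) = p ^ (CARD('r) - 1) * q" for k :: 'r
  proof -
    have "(\<Prod>l\<in>UNIV. pdet (drop_from {k} j (\<lambda>_. UNIV) l) ?t) =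
      pdet (UNIV - {j}) ?t * (\<Prod>l\<in>UNIV - {k}. pdet UNIV ?t)"
      by (subst prod.remove[of _ k]) (auto simp: drop_from_def intro!: prod.cong)
    also have "\<dots> = complex_of_real (p ^ (CARD('r) - 1) * q)"
      by (simp add: pc mult.commute)
    finally have "complex_of_real (rmixed [] (drop_from {k} j (\<lambda>_. UNIV)) (\<lambda>_ _. t)) = complex_of_real (p ^ (CARD('r) - 1) * q)"
      by (simp only: of_real_rmixed mixed.simps)
    then show ?thesis by (simp only: of_real_eq_iff)
  qed
  moreover have "rmixed [] (\<lambda>_ :: 'r. UNIV) (\<lambda>_ _. t) = p ^ CARD('r)"
  proof -
    have "complex_of_real (rmixed [] (\<lambda>_ :: 'r. UNIV) (\<lambda>_ _. t)) = complex_of_real (p ^ CARD('r))"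
      unfolding of_real_rmixed by (simp add: pc)
    then show ?thesis by (simp only: of_real_eq_iff)
  qed
  ultimately show ?thesis using mult_left_mono[OF le, of "real CARD('r)"] by (simp add: mult.assoc)
qed

text \<open>Distributed indices sit at \<open>t - \<delta>\<close>, the others at \<open>t\<close>
  with potential still at most \<open>\<phi>\<close>, so the same \<open>\<delta>\<close> is
  admissible in every step.\<close>

lemma barrier_iterate:
  fixes t \<delta> \<phi> :: real
  assumes ev: "even CARD('r::finite)" and t: "t > 1"
    and pot: "\<And>j. (\<Sum>k\<in>(UNIV :: 'r set). rmixed [] (drop_from {k} j (\<lambda>_. UNIV)) (\<lambda>_ _. t)) \<le>
       \<phi> * rmixed [] (\<lambda>_ :: 'r. UNIV) (\<lambda>_ _. t)"
    and shift: "\<And>s :: nat \<Rightarrow> real. (\<And>l. l < CARD('r) \<Longrightarrow> 0 < s l \<and> s l \<le> t) \<Longrightarrow> (\<Sum>l<CARD('r). 1 / s l) \<le> \<phi> \<Longrightarrow>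
        (\<forall>l<CARD('r). real CARD('r) * \<delta> \<le> (\<Sum>m\<in>{..<CARD('r)} - {l}. s m))"
    and "distinct is"
  shows "pos_above is (\<lambda>_ :: 'r. - set is) (\<lambda>_ j. if j \<in> set is then t - \<delta> else t) \<and>
    (\<forall>j. j \<notin> set is \<longrightarrow> (\<Sum>k\<in>(UNIV :: 'r set). rmixed is (drop_from {k} j (\<lambda>_. - set is)) (\<lambda>_ j. if j \<in> set is then t - \<delta> else t)) \<le>
       \<phi> * rmixed is (\<lambda>_ :: 'r. - set is) (\<lambda>_ j. if j \<in> set is then t - \<delta> else t))"
  using \<open>distinct is\<close>
proof (induction "is")
  case Nil
  have "pos_above [] (\<lambda>_ :: 'r. UNIV) (\<lambda>_ _. t)"
    unfolding pos_above_def using t by (auto intro!: rmixed_large intro: less_le_trans)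
  then show ?case using pot by simp
next
  case (Cons i "is")
  let ?S = "\<lambda>_ :: 'r. - set is" and ?x = "\<lambda>(_ :: 'r) j. if j \<in> set is then t - \<delta> else t"
  have adm: "admissible is ?S" using Cons.prems by (auto simp: admissible_def)
  have i: "i \<in> ?S l" for l using Cons.prems by simp
  have xi: "?x k i = t" for k using Cons.prems by simp
  have S: "drop_from UNIV i ?S = (\<lambda>_. - set (i # is))" by (auto simp: drop_from_def fun_eq_iff)
  have x: "(\<lambda>k j. if j = i then ?x k j + (- \<delta>) else ?x k j) = (\<lambda>_ j. if j \<in> set (i # is) then t - \<delta> else t)"
    using Cons.prems by (auto simp: fun_eq_iff)
  have IH: "pos_above is ?S ?x" "\<And>j. j \<notin> set is \<Longrightarrow> (\<Sum>k\<in>UNIV. rmixed is (drop_from {k} j ?S) ?x) \<le> \<phi> * rmixed is ?S ?x"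
    using Cons by auto
  have poti: "(\<Sum>k\<in>UNIV. rmixed is (drop_from {k} i ?S) ?x) \<le> \<phi> * rmixed is ?S ?x"
    using Cons.prems by (intro IH(2)) simp
  note step = barrier_step[of "is" ?S i ?x t \<phi> \<delta>, OF ev adm i IH(1) xi poti shift, unfolded S x]
  show ?case
    by (intro conjI allI impI step) (use IH(2) in auto)
qed

section \<open>Norms of compressions and the choice of constants\<close>

lemma pdet_eq_0I:
  assumes "v \<noteq> 0" "\<And>i. i \<notin> S \<Longrightarrow> v $ i = 0" "\<And>i. i \<in> S \<Longrightarrow> x i * v $ i = (A *v v) $ i"
  shows "pdet S x = 0"
proof (rule ccontr)
  have "(\<Sum>j\<in>UNIV. pmat S x $ i $ j * v $ j) = 0" for i
  proof (cases "i \<in> S")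
    case True
    have "(\<Sum>j\<in>UNIV. pmat S x $ i $ j * v $ j) = (\<Sum>j\<in>UNIV. (if i = j then x i * v $ j else 0) - A $ i $ j * v $ j)"
      using True assms(2) by (intro sum.cong) (auto simp: pmat_def algebra_simps)
    then show ?thesis using assms(3)[OF True] by (simp add: sum_subtractf matrix_vector_mult_def)
  next
    case False
    then show ?thesis using assms(2)
      by (simp add: pmat_def if_distrib[of "\<lambda>x. x * _"] cong: if_cong)
  qed
  then have "pmat S x *v v = 0" by (simp add: vec_eq_iff matrix_vector_mult_def)
  moreover assume "pdet S x \<noteq> 0"
  then have "\<exists>B. B ** pmat S x = mat 1"
    by (simp add: pdet_def invertible_det_nz[symmetric] invertible_left_inverse)
  ultimately show False using assms(1) unfolding matrix_left_invertible_ker by blast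
qed

definition compression :: "'n set \<Rightarrow> complex ^ 'n ^ 'n" where
  "compression S = (\<chi> i j. if i \<in> S \<and> j \<in> S then A $ i $ j else 0)"

text \<open>An eigenvector for a top eigenvalue \<open>l > r > 0\<close> is supported on
  \<open>S\<close> because \<open>l\<close> is nonzero, so \<open>l\<close> would be a root of the
  characteristic polynomial of the block.\<close>

lemma compression_norm_le:
  assumes r: "r > 0" and nz: "\<And>s. s > r \<Longrightarrow> pdet S (\<lambda>_. complex_of_real s) \<noteq> 0"
  shows "norm (compression S *v v) \<le> r * norm v"
proof -
  let ?B = "compression S"
  let ?P = "\<lambda>v :: complex ^ 'n. (\<chi> i. if i \<in> S then v $ i else 0)"
  have mult: "?B *v w = ?P (A *v ?P w)" for w
    by (auto simp: vec_eq_iff matrix_vector_mult_def compression_def intro!: sum.cong)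
  have herm_B: "hermitian ?B"
    by (auto simp: hermitian_def conjugate_transpose_def compression_def vec_eq_iff hermitian_cnj[OF herm])
  have "w \<bullet> (?B *v w) = ?P w \<bullet> (A *v ?P w)" for w
    unfolding mult inner_vec_def by (intro sum.cong) auto
  then have nn: "0 \<le> w \<bullet> (?B *v w)" for w using form_nonneg by simp
  obtain l u where l: "u \<noteq> 0" "?B *v u = complex_of_real l *s u" "\<And>w. w \<bullet> (?B *v w) \<le> l * (w \<bullet> w)"
    using rayleigh_max[OF herm_B] by metis
  have "l \<le> r"
  proof (rule ccontr)
    assume "\<not> l \<le> r"
    then have lr: "l > r" by simp
    have eq: "complex_of_real l * u $ i = (?B *v u) $ i" for i using l(2) by simp
    have out: "u $ i = 0" if "i \<notin> S" for i
      using eq[of i] that lr r by (simp add: mult)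
    then have Pu: "?P u = u" by (auto simp: vec_eq_iff)
    have "pdet S (\<lambda>_. complex_of_real l) = 0"
      using l(1) out by (rule pdet_eq_0I) (use eq in \<open>simp_all add: mult Pu\<close>)
    then show False using nz[OF lr] by simp
  qed
  then have "w \<bullet> (?B *v w) \<le> r * (w \<bullet> w)" for w
    using l(3)[of w] mult_right_mono[of l r "w \<bullet> w"] by simp
  with herm_B nn show ?thesis using r by (rule psd_norm_le)
qed

lemma four_paving:
  assumes diag: "\<And>i. Re (A $ i $ i) \<le> 1 / 2"
  shows "\<exists>b :: 'n \<Rightarrow> 4. \<forall>k v. norm (compression {i. b i = k} *v v) \<le> (7 + 2 * sqrt 6) / 12 * norm v"
proof -
  define w where "w = sqrt 6"
  have w: "w * w = 6" "w > 0" by (simp_all add: w_def)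
  have w2: "w > 2" "w < 3" unfolding w_def by (auto intro: real_less_rsqrt real_less_lsqrt)
  \<comment> \<open>\<open>\<phi>\<close> is the initial potential for four blocks and diagonal
    bound 1/2. With \<open>\<delta> = 9 t (t - 1) / (4 (3 t - 1))\<close>, this \<open>t\<close>
    minimises \<open>t - \<delta>\<close> over \<open>t > 1\<close>.\<close>
  define t where "t = (1 + w) / 3"
  define \<delta> where "\<delta> = w / 6 - 1 / 4"
  define \<phi> where "\<phi> = 4 * ((1 / 2) / (t - 1) + (1 - 1 / 2) / t)"
  have t: "t > 1" using w2 by (simp add: t_def)
  \<comment> \<open>Setting aside one \<open>s l \<le> t\<close> leaves three reciprocals with sum
    at most \<open>\<phi> - 1 / t\<close>; by the inequality of means the three numbers sum to at
    least \<open>9 / (\<phi> - 1 / t) = 4 \<delta>\<close>.\<close>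
  have psi: "\<phi> - 1 / t = 9 / (4 * \<delta>)"
  proof -
    have "t - 1 = (w - 2) / 3" by (simp add: t_def)
    then have "1 / (t - 1) = 3 / (w - 2)" "1 / t = 3 / (1 + w)" by (simp only:, simp) (simp add: t_def)
    moreover have "\<phi> - 1 / t = 2 * (1 / (t - 1)) + 1 / t"
      using t by (simp add: \<phi>_def field_simps)
    ultimately have "\<phi> - 1 / t = 6 / (w - 2) + 3 / (1 + w)" by simp
    also have "\<dots> = 9 * w / (4 - w)"
      using w w2 by (simp add: divide_simps) (simp add: algebra_simps)
    also have "\<dots> = 9 / (4 * \<delta>)"
      using w w2 by (simp add: \<delta>_def divide_simps) (simp add: algebra_simps)
    finally show ?thesis .
  qed
  have \<delta>: "\<delta> > 0" using w2 by (simp add: \<delta>_def)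
  have C4: "CARD(4) = 4" by simp
  have shift: "\<forall>l<CARD(4). real CARD(4) * \<delta> \<le> (\<Sum>m\<in>{..<CARD(4)} - {l}. s m)"
    if s: "\<And>l. l < CARD(4) \<Longrightarrow> 0 < s l \<and> s l \<le> t" and sum: "(\<Sum>l<CARD(4). 1 / s l) \<le> \<phi>" for s :: "nat \<Rightarrow> real"
  proof (intro allI impI)
    fix l assume l: "l < CARD(4)"
    have "(\<Sum>m<CARD(4). 1 / s m) = 1 / s l + (\<Sum>m\<in>{..<CARD(4)} - {l}. 1 / s m)"
      using l by (intro sum.remove) auto
    moreover have "1 / t \<le> 1 / s l" using s[OF l] t by (intro divide_left_mono) auto
    ultimately have "(\<Sum>m\<in>{..<CARD(4)} - {l}. 1 / s m) \<le> 9 / (4 * \<delta>)" using sum psi by linarith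
    then have "(real (card ({..<CARD(4)} - {l})))\<^sup>2 / (9 / (4 * \<delta>)) \<le> (\<Sum>m\<in>{..<CARD(4)} - {l}. s m)"
      using s \<delta> by (intro sum_ge_if_sum_inverse_le) auto
    moreover have "card ({..<CARD(4)} - {l}) = 3" using l by simp
    ultimately show "real CARD(4) * \<delta> \<le> (\<Sum>m\<in>{..<CARD(4)} - {l}. s m)" by simp
  qed
  obtain "is" :: "'n list" where il: "set is = UNIV" "distinct is"
    using finite_distinct_list[OF finite] by blast
  have "pos_above is (\<lambda>_ :: 4. - set is) (\<lambda>_ j. if j \<in> set is then t - \<delta> else t)"
    using barrier_iterate[where 'r = 4 and t = t and \<delta> = \<delta> and \<phi> = \<phi>, OF _ t _ shift il(2)]
      initial_potential[where 'r = 4, OF t diag] by (simp add: \<phi>_def)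
  then have pa: "pos_above is (\<lambda>_ :: 4. {}) (\<lambda>_ _. t - \<delta>)" by (simp add: il(1))
  define r where "r = (7 + 2 * sqrt 6) / 12"
  have r: "t - \<delta> = r" by (simp add: t_def \<delta>_def r_def w_def field_simps)
  have r0: "r > 0" by (simp add: r_def add_pos_nonneg)
  have "rmixed is (\<lambda>_ :: 4. {}) (\<lambda>_ _. s) > 0" if "s > r" for s
    using pa that unfolding pos_above_def r by (auto intro: less_imp_le)
  then obtain b :: "'n \<Rightarrow> 4" where b: "\<And>s. s > r \<Longrightarrow> rmixed [] (\<lambda>k. {} \<union> {i \<in> set is. b i = k}) (\<lambda>_ _. s) > 0"
    using partition_choice[of "is" "\<lambda>_ :: 4. {}" r] il(2) by (auto simp: admissible_def)
  have "pdet {i. b i = k} (\<lambda>_. complex_of_real s) \<noteq> 0" if "s > r" for k s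
  proof
    assume z: "pdet {i. b i = k} (\<lambda>_. complex_of_real s) = 0"
    have "(\<Prod>k\<in>UNIV. pdet {i. b i = k} (\<lambda>_. complex_of_real s)) = 0"
      by (rule prod_zero) (use z in auto)
    then have "rmixed [] (\<lambda>k. {} \<union> {i \<in> set is. b i = k}) (\<lambda>_ _. s) = 0"
      by (simp add: rmixed_def il(1) del: prod_zero_iff)
    then show False using b[OF that] by simp
  qed
  then have "norm (compression {i. b i = k} *v v) \<le> r * norm v" for k v
    using r0 by (intro compression_norm_le)
  then show ?thesis unfolding r_def by blast
qed

end

theorem corollary1p5:
  fixes A :: "complex ^ 'n ^ 'n" and \<alpha> :: real
  assumes "psd_contraction A"
    and "\<And>i. Re (A $ i $ i) \<le> \<alpha>"
    and "\<alpha> \<le> 1 / 2"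
  shows "\<exists>Q :: nat \<Rightarrow> complex ^ 'n ^ 'n.
    (\<forall>i \<in> {1..4}. diagonal_projection (Q i)) \<and>
    (\<Sum>i = 1..4. Q i) = mat 1 \<and>
    (\<forall>i \<in> {1..4}. operator_norm (Q i ** A ** Q i) \<le> (7 + 2 * sqrt 6) / 12)"
proof -
  interpret psd_contractive A using assms(1) by (rule psd_contractiveI)
  have "Re (A $ i $ i) \<le> 1 / 2" for i using assms(2)[of i] assms(3) by linarith
  then obtain b :: "'n \<Rightarrow> 4" where b: "\<And>k v. norm (compression {i. b i = k} *v v) \<le> (7 + 2 * sqrt 6) / 12 * norm v"
    using four_paving by blast
  \<comment> \<open>In the numeral type \<open>4\<close> the number \<open>of_nat 4\<close> is 0, so
    \<open>m = 1, ..., 4\<close> meets each block exactly once.\<close>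
  define Q :: "nat \<Rightarrow> complex ^ 'n ^ 'n" where "Q = (\<lambda>m. \<chi> i j. if i = j then if b j = of_nat m then 1 else 0 else 0)"
  have Qm: "(Q m ** M) $ i $ j = (if b i = of_nat m then M $ i $ j else 0)" for m i j and M :: "complex ^ 'n ^ 'n"
    by (simp add: Q_def matrix_matrix_mult_def if_distrib[of "\<lambda>x. x * _"] cong: if_cong)
  have mQ: "(M ** Q m) $ i $ j = (if b j = of_nat m then M $ i $ j else 0)" for m i j and M :: "complex ^ 'n ^ 'n"
    by (simp add: Q_def matrix_matrix_mult_def if_distrib[of "\<lambda>x. _ * x"] cong: if_cong)
  have "diagonal_projection (Q m)" for m
    unfolding diagonal_projection_def diagonal_matrix_def conjugate_transpose_def vec_eq_iff Qm
    by (auto simp: Q_def)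
  moreover have "(\<Sum>m = 1..4. Q m) = mat 1"
  proof -
    have "{1..4} = {1, 2, 3, 4 :: nat}" by auto
    moreover have "(\<Sum>m\<in>{1, 2, 3, 4 :: nat}. Q m $ i $ j) = (if i = j then 1 else 0)" for i j
      using exhaust_4[of "b i"] by (auto simp: Q_def)
    ultimately show ?thesis by (simp add: vec_eq_iff mat_def sum_component)
  qed
  moreover have "operator_norm (Q m ** A ** Q m) \<le> (7 + 2 * sqrt 6) / 12" for m
  proof -
    have "Q m ** A ** Q m = compression {i. b i = of_nat m}"
      by (auto simp: vec_eq_iff mQ Qm compression_def)
    then show ?thesis unfolding operator_norm_def by (simp only:) (rule onorm_le, rule b)
  qed
  ultimately show ?thesis by blast
qed

end
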